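(* The prefixes $123$ and $321$ may be exchanged. That is, for every $k\ge 3$, every ordering $\tau=\tau_4\ldots\tau_k$ of $\{4,\dots,k\}$, and every $n$, $\mathcal{I}_n(123\tau_4\ldots\tau_k)=\mathcal{I}_n(321\tau_4\ldots\tau_k)$.
   Context: A permutation $\pi=\pi_1\ldots\pi_n\in\mathcal{S}_n$ avoids $\sigma\in\mathcal{S}_k$ if there is no subsequence $\pi_{i_1}\ldots\pi_{i_k}$, $i_1<\cdots<i_k$, whose order-preserving relabelling by $1,\dots,k$ is $\sigma$. $\mathcal{I}_n(\sigma)$ denotes the number of involutions in $\mathcal{S}_n$ (permutations whose square is the identity) which avoid $\sigma$. Write $\sigma\sim_{\mathcal I}\sigma'$ if $\mathcal{I}_n(\sigma)=\mathcal{I}_n(\sigma')$ for every $n$. For $\alpha,\beta\in\mathcal{S}_j$, the prefixes $\alpha$ and $\beta$ may be exchanged if for every $k\ge j$ and every ordering $\tau=\tau_{j+1}\ldots\tau_k$ of $\{j+1,\dots,k\}$, $\alpha_1\ldots\alpha_j\tau_{j+1}\ldots\tau_k\sim_{\mathcal I}\beta_1\ldots\beta_j\tau_{j+1}\ldots\tau_k$. *)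

theory Defs
  imports
    "HOL-Combinatorics.Permutations"
    "HOL-Combinatorics.Multiset_Permutations"
    "HOL-Library.Sublist"
begin

text \<open>
  Patterns are written in one-line notation, as lists of naturals: the elements of $S_k$ are
  the members of \<^term>\<open>permutations_of_set {1..k::nat}\<close>. The permutations whose pattern avoidance
  is counted are functions \<open>\<pi>\<close> with \<open>\<pi> permutes {1..n}\<close>, so that being an involution is literally
  \<open>\<pi> \<circ> \<pi> = id\<close>.
\<close>

definition one_line :: "nat \<Rightarrow> (nat \<Rightarrow> nat) \<Rightarrow> nat list" where
  "one_line n \<pi> = map \<pi> [1..<Suc n]"

text \<open>
  \<open>f\<close> is the order-preserving relabelling: if \<open>\<sigma>\<close> is a permutation of \<open>{1..k}\<close>, then
  \<open>map f ys = \<sigma>\<close> makes \<open>f\<close> the unique increasing bijection from \<open>set ys\<close> onto \<open>{1..k}\<close>.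
\<close>

definition contains_pattern :: "nat list \<Rightarrow> nat list \<Rightarrow> bool" where
  "contains_pattern w \<sigma> \<longleftrightarrow>
     (\<exists>ys f. subseq ys w \<and> strict_mono_on (set ys) f \<and> map f ys = \<sigma>)"

definition avoids :: "nat list \<Rightarrow> nat list \<Rightarrow> bool" where
  "avoids w \<sigma> \<longleftrightarrow> \<not> contains_pattern w \<sigma>"

definition avoiding_involutions :: "nat \<Rightarrow> nat list \<Rightarrow> (nat \<Rightarrow> nat) set" where
  "avoiding_involutions n \<sigma> =
     {\<pi>. \<pi> permutes {1..n} \<and> \<pi> \<circ> \<pi> = id \<and> avoids (one_line n \<pi>) \<sigma>}"

definition num_avoiding_involutions :: "nat \<Rightarrow> nat list \<Rightarrow> nat" where
  "num_avoiding_involutions n \<sigma> = card (avoiding_involutions n \<sigma>)"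

definition involution_equiv :: "nat list \<Rightarrow> nat list \<Rightarrow> bool"  (infix "\<sim>\<^sub>I" 50) where
  "\<sigma> \<sim>\<^sub>I \<sigma>' \<longleftrightarrow> (\<forall>n. num_avoiding_involutions n \<sigma> = num_avoiding_involutions n \<sigma>')"

text \<open>Intended for \<open>\<alpha>\<close> and \<open>\<beta>\<close> in \<^term>\<open>permutations_of_set {1..j::nat}\<close>.\<close>

definition prefixes_exchangeable :: "nat \<Rightarrow> nat list \<Rightarrow> nat list \<Rightarrow> bool" where
  "prefixes_exchangeable j \<alpha> \<beta> \<longleftrightarrow>
     (\<forall>k\<ge>j. \<forall>\<tau>\<in>permutations_of_set {j+1..k}. \<alpha> @ \<tau> \<sim>\<^sub>I \<beta> @ \<tau>)"

end

theory Submission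
  imports Defs
begin

text \<open>
  Fix \<open>\<tau>\<close>. In the permutation matrix of an involution the cells below and to the left of an
  occurrence of \<open>\<tau>\<close> or \<open>\<tau>\<inverse>\<close> form a symmetric Ferrers board, which depends only on the
  entries outside of it. The involution contains \<open>123\<tau>\<close> or \<open>321\<tau>\<close> iff the entries in the
  board contain \<open>123\<close> or \<open>321\<close>. So it suffices to count, for a symmetric Ferrers board and a
  given set of nonempty columns, the symmetric fillings that avoid \<open>123\<close> or \<open>321\<close>.

  Both kinds of fillings are encoded by Fomin growth diagrams, with partitions with at most two
  columns for \<open>123\<close> and at most two rows for \<open>321\<close>. After transposition of the former both are
  determined by the partitions along the boundary of the board, and the same boundary sequences
  occur. The symmetric fillings correspond to the palindromic sequences, and the nonempty columns
  are the boundary steps at which the partition changes.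
\<close>

section \<open>Growth diagrams on Ferrers boards\<close>

text \<open>
  A label \<open>(a, b)\<close> stands for a partition with two parts. The parts are row lengths when the
  pattern is \<open>321\<close> and column lengths when it is \<open>123\<close>.
\<close>

type_synonym label = "nat \<times> nat"

definition step :: "label \<Rightarrow> label \<Rightarrow> bool" where
  "step p q \<longleftrightarrow> snd p \<le> fst p \<and> snd q \<le> fst q \<and>
     (q = p \<or> q = (Suc (fst p), snd p) \<or> q = (fst p, Suc (snd p)))"

text \<open>
  The cell \<open>(i, j)\<close> has lower left corner \<open>(i, j)\<close> and upper right corner \<open>(Suc i, Suc j)\<close>;
  the arguments of a local rule are the labels at the lower left, upper left and lower right
  corners of a cell, followed by the entry of the cell.
\<close>

fun growth :: "(label \<Rightarrow> label \<Rightarrow> label \<Rightarrow> bool \<Rightarrow> label) \<Rightarrow> (nat \<times> nat) set \<Rightarrow> nat \<Rightarrow> nat \<Rightarrow> label" where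
  "growth F A 0 j = (0, 0)"
| "growth F A (Suc i) 0 = (0, 0)"
| "growth F A (Suc i) (Suc j) =
     F (growth F A i j) (growth F A i (Suc j)) (growth F A (Suc i) j) ((i, j) \<in> A)"

definition down_closed :: "(nat \<times> nat) set \<Rightarrow> bool" where
  "down_closed B \<longleftrightarrow> (\<forall>i j u v. (i, j) \<in> B \<longrightarrow> u \<le> i \<longrightarrow> v \<le> j \<longrightarrow> (u, v) \<in> B)"

text \<open>
  The corner points on the upper right boundary path of \<open>B\<close>, which includes the parts of the
  two axes that lie beyond the board.
\<close>

definition boundary :: "(nat \<times> nat) set \<Rightarrow> (nat \<times> nat) set" where
  "boundary B = {(i, j). (i, j) \<notin> B \<and> (i = 0 \<or> j = 0 \<or> (i - 1, j - 1) \<in> B)}"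

text \<open>No local rule enters this condition. On a finite board both rules realise exactly these
  boundary labellings, which lets fillings for one rule be exchanged for fillings for the
  other.\<close>

definition admissible :: "(nat \<times> nat) set \<Rightarrow> (nat \<Rightarrow> nat \<Rightarrow> label) \<Rightarrow> bool" where
  "admissible B s \<longleftrightarrow>
     (\<forall>i j. (i, j) \<in> boundary B \<longrightarrow> i = 0 \<or> j = 0 \<longrightarrow> s i j = (0, 0)) \<and>
     (\<forall>i j. (i, j) \<in> boundary B \<longrightarrow> (Suc i, j) \<in> boundary B \<longrightarrow> step (s i j) (s (Suc i) j)) \<and>
     (\<forall>i j. (i, j) \<in> boundary B \<longrightarrow> (i, Suc j) \<in> boundary B \<longrightarrow> step (s i j) (s i (Suc j)))"

definition partial_perm :: "('a \<times> 'a) set \<Rightarrow> bool" where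
  "partial_perm A \<longleftrightarrow> single_valued A \<and> single_valued (A\<inverse>)"

lemma admissibleD:
  assumes "admissible B s" "(i, j) \<in> boundary B"
  shows "i = 0 \<or> j = 0 \<Longrightarrow> s i j = (0, 0)"
    and "(Suc i, j) \<in> boundary B \<Longrightarrow> step (s i j) (s (Suc i) j)"
    and "(i, Suc j) \<in> boundary B \<Longrightarrow> step (s i j) (s i (Suc j))"
  using assms unfolding admissible_def by blast+

lemma growth_0_right [simp]: "growth F A i 0 = (0, 0)"
  by (cases i) auto

lemma growth_cong:
  assumes "\<And>u v. u < i \<Longrightarrow> v < j \<Longrightarrow> (u, v) \<in> A \<longleftrightarrow> (u, v) \<in> A'"
  shows "growth F A i j = growth F A' i j"
  using assms
proof (induction F A i j rule: growth.induct)
  case (3 F A i j)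
  have "growth F A i j = growth F A' i j" "growth F A i (Suc j) = growth F A' i (Suc j)"
    "growth F A (Suc i) j = growth F A' (Suc i) j"
    using 3 by auto
  then show ?case using "3.prems"[of i j] by simp
qed auto

lemma down_closedD: "down_closed B \<Longrightarrow> (i, j) \<in> B \<Longrightarrow> u \<le> i \<Longrightarrow> v \<le> j \<Longrightarrow> (u, v) \<in> B"
  unfolding down_closed_def by blast

text \<open>\<open>OK\<close> rules out the cells whose growth two parts cannot record. On the
  remaining cells \<open>F_ex\<close> and \<open>F_inj\<close> make the rule invertible once
  \<open>m\<close> and \<open>n\<close> are known. \<open>F_step\<close> treats only the edge from
  \<open>m\<close>; the edge from \<open>n\<close> follows from \<open>F_commute\<close> and
  \<open>OK_commute\<close>.\<close>

locale local_rule =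
  fixes F :: "label \<Rightarrow> label \<Rightarrow> label \<Rightarrow> bool \<Rightarrow> label"
    and OK :: "label \<Rightarrow> label \<Rightarrow> label \<Rightarrow> bool \<Rightarrow> bool"
  assumes F_commute: "F r m n e = F r n m e"
    and OK_commute: "OK r m n e = OK r n m e"
    and F_step: "step r m \<Longrightarrow> step r n \<Longrightarrow> (e \<Longrightarrow> m = r \<and> n = r) \<Longrightarrow> OK r m n e \<Longrightarrow>
      step m (F r m n e) \<and> (m = F r m n e \<longleftrightarrow> r = n \<and> \<not> e)"
    and F_ex: "step m l \<Longrightarrow> step n l \<Longrightarrow>
      \<exists>r e. step r m \<and> step r n \<and> (e \<longrightarrow> m = r \<and> n = r) \<and> OK r m n e \<and> F r m n e = l"
    and F_inj: "step r m \<Longrightarrow> step r n \<Longrightarrow> (e \<Longrightarrow> m = r \<and> n = r) \<Longrightarrow> OK r m n e \<Longrightarrow>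
      step r' m \<Longrightarrow> step r' n \<Longrightarrow> (e' \<Longrightarrow> m = r' \<and> n = r') \<Longrightarrow> OK r' m n e' \<Longrightarrow>
      F r m n e = F r' m n e' \<Longrightarrow> r = r' \<and> e = e'"
begin

definition fits :: "label \<Rightarrow> label \<Rightarrow> label \<Rightarrow> bool \<Rightarrow> bool" where
  "fits r m n e \<longleftrightarrow> step r m \<and> step r n \<and> (e \<longrightarrow> m = r \<and> n = r) \<and> OK r m n e"

definition cell :: "(nat \<times> nat) set \<Rightarrow> nat \<Rightarrow> nat \<Rightarrow> bool" where
  "cell A i j \<longleftrightarrow> fits (growth F A i j) (growth F A i (Suc j)) (growth F A (Suc i) j) ((i, j) \<in> A)"

definition good :: "(nat \<times> nat) set \<Rightarrow> (nat \<times> nat) set \<Rightarrow> bool" where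
  "good B A \<longleftrightarrow> A \<subseteq> B \<and> (\<forall>(i, j)\<in>B. cell A i j)"

lemma cellD:
  assumes "cell A i j"
  shows "step (growth F A i j) (growth F A i (Suc j))"
    and "step (growth F A i j) (growth F A (Suc i) j)"
    and "step (growth F A i (Suc j)) (growth F A (Suc i) (Suc j))"
    and "step (growth F A (Suc i) j) (growth F A (Suc i) (Suc j))"
    and "(i, j) \<in> A \<Longrightarrow> growth F A i (Suc j) = growth F A i j"
    and "(i, j) \<in> A \<Longrightarrow> growth F A (Suc i) j = growth F A i j"
    and "growth F A i (Suc j) = growth F A (Suc i) (Suc j) \<longleftrightarrow>
           growth F A i j = growth F A (Suc i) j \<and> (i, j) \<notin> A"
    and "growth F A (Suc i) j = growth F A (Suc i) (Suc j) \<longleftrightarrow>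
           growth F A i j = growth F A i (Suc j) \<and> (i, j) \<notin> A"
    and "OK (growth F A i j) (growth F A i (Suc j)) (growth F A (Suc i) j) ((i, j) \<in> A)"
  using assms F_step[of "growth F A i j" "growth F A i (Suc j)" "growth F A (Suc i) j" "(i, j) \<in> A"]
    F_step[of "growth F A i j" "growth F A (Suc i) j" "growth F A i (Suc j)" "(i, j) \<in> A"]
  unfolding cell_def fits_def
  by (auto simp: F_commute[of _ "growth F A (Suc i) j"] OK_commute[of _ "growth F A (Suc i) j"])

lemma cell_cong:
  assumes "\<And>u v. u \<le> i \<Longrightarrow> v \<le> j \<Longrightarrow> (u, v) \<in> A \<longleftrightarrow> (u, v) \<in> A'"
  shows "cell A i j = cell A' i j"
proof -
  have "growth F A i j = growth F A' i j" "growth F A i (Suc j) = growth F A' i (Suc j)"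
    "growth F A (Suc i) j = growth F A' (Suc i) j"
    by (rule growth_cong; use assms in auto)+
  then show ?thesis using assms by (simp add: cell_def)
qed

text \<open>Transposition swaps the roles of \<open>m\<close> and \<open>n\<close>, which
  \<open>F_commute\<close> permits. Hence symmetric fillings have labels that are symmetric in the
  diagonal.\<close>

lemma growth_converse: "growth F (A\<inverse>) j i = growth F A i j"
proof (induction i arbitrary: j)
  case (Suc i)
  note IH = Suc
  show ?case
    by (induction j) (auto simp: IH F_commute)
qed simp

lemma cell_converse: "cell (A\<inverse>) j i = cell A i j"
  unfolding cell_def fits_def growth_converse by (auto simp: OK_commute)

lemma good_converse: "good B A \<Longrightarrow> good (B\<inverse>) (A\<inverse>)"
  unfolding good_def by (auto simp: cell_converse)

text \<open>On the axis the bottom edge of the column is trivial. By \<open>F_step\<close> the top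
  edge of a cell is trivial iff its bottom edge is trivial and the cell is empty, so a change caused
  by an entry persists upwards.\<close>

lemma col_change:
  assumes "\<And>v. v < j \<Longrightarrow> cell A i v"
  shows "growth F A i j \<noteq> growth F A (Suc i) j \<longleftrightarrow> (\<exists>v<j. (i, v) \<in> A)"
  using assms
proof (induction j)
  case (Suc j)
  have "cell A i j" using Suc.prems by auto
  from cellD(7)[OF this] Suc.IH Suc.prems show ?case
    by (metis less_Suc_eq)
qed auto

lemma row_change:
  assumes "\<And>u. u < i \<Longrightarrow> cell A u j"
  shows "growth F A i j \<noteq> growth F A i (Suc j) \<longleftrightarrow> (\<exists>u<i. (u, j) \<in> A)"
  using col_change[of i "A\<inverse>" j] assms
  by (auto simp: growth_converse cell_converse)

text \<open>An entry requires equal labels at three corners of its cell; an earlier entry in the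
  same row or column would already have made two of them differ.\<close>

lemma good_partial_perm:
  assumes "good B A" "down_closed B"
  shows "partial_perm A"
proof -
  have c: "cell A u v" if "(i, j) \<in> A" "u \<le> i" "v \<le> j" for i j u v
    using assms that unfolding good_def by (auto dest: down_closedD)
  have 1: "v \<ge> j" if "(i, v) \<in> A" "(i, j) \<in> A" for i j v
  proof (rule ccontr)
    assume "\<not> v \<ge> j"
    then have "growth F A i j \<noteq> growth F A (Suc i) j"
      using col_change[of j A i] c[OF that(2)] that by auto
    then show False using cellD(6)[OF c[OF that(2)]] that by auto
  qed
  have 2: "u \<ge> i" if "(u, j) \<in> A" "(i, j) \<in> A" for i j u
  proof (rule ccontr)
    assume "\<not> u \<ge> i"
    then have "growth F A i j \<noteq> growth F A i (Suc j)"
      using row_change[of i A j] c[OF that(2)] that by auto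
    then show False using cellD(5)[OF c[OF that(2)]] that by auto
  qed
  show ?thesis unfolding partial_perm_def single_valued_def
    using 1 2 by (auto intro: antisym)
qed

text \<open>For a partial permutation only \<open>OK\<close> is a genuine condition: the steps come
  from the neighbouring cells on the left and below, and the condition on entries from
  \<open>row_change\<close> and \<open>col_change\<close>.\<close>

lemma goodI:
  assumes B: "down_closed B" and A: "A \<subseteq> B" "partial_perm A"
    and OK: "\<And>i j. (i, j) \<in> B \<Longrightarrow> (\<And>u v. u \<le> i \<Longrightarrow> v \<le> j \<Longrightarrow> (u, v) \<noteq> (i, j) \<Longrightarrow> cell A u v) \<Longrightarrow>
      OK (growth F A i j) (growth F A i (Suc j)) (growth F A (Suc i) j) ((i, j) \<in> A)"
  shows "good B A"
proof -
  have "cell A i j" if "(i, j) \<in> B" for i j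
    using that
  proof (induction "i + j" arbitrary: i j rule: less_induct)
    case less
    have c: "cell A u v" if "u \<le> i" "v \<le> j" "(u, v) \<noteq> (i, j)" for u v
      using less.hyps[of u v] that down_closedD[OF B less.prems, of u v] by auto
    have 1: "step (growth F A i j) (growth F A i (Suc j))"
    proof (cases i)
      case (Suc i')
      then show ?thesis using cellD(4)[OF c[of i' j]] by auto
    qed (auto simp: step_def)
    have 2: "step (growth F A i j) (growth F A (Suc i) j)"
    proof (cases j)
      case (Suc j')
      then show ?thesis using cellD(3)[OF c[of i j']] by auto
    qed (auto simp: step_def)
    have 3: "growth F A i (Suc j) = growth F A i j" "growth F A (Suc i) j = growth F A i j"
      if "(i, j) \<in> A"
    proof -
      have "\<not> (\<exists>u<i. (u, j) \<in> A)" "\<not> (\<exists>v<j. (i, v) \<in> A)"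
        using A(2) that unfolding partial_perm_def single_valued_def
        by (metis converse_iff less_irrefl)+
      then show "growth F A i (Suc j) = growth F A i j" "growth F A (Suc i) j = growth F A i j"
        using row_change[of i A j] col_change[of j A i] c by auto
    qed
    show ?case unfolding cell_def fits_def
      using 1 2 3 OK[OF less.prems c] by auto
  qed
  then show ?thesis using A unfolding good_def by auto
qed

section \<open>Fillings and their labels along the boundary\<close>

lemma good_admissible:
  assumes "good B A"
  shows "admissible B (growth F A)"
  unfolding admissible_def
proof (intro conjI allI impI)
  fix i j assume *: "(i, j) \<in> boundary B" "(Suc i, j) \<in> boundary B"
  show "step (growth F A i j) (growth F A (Suc i) j)"
  proof (cases j)
    case (Suc j')
    with * have "(i, j') \<in> B" by (auto simp: boundary_def)
    then show ?thesis using assms cellD(3)[of A i j'] Suc by (auto simp: good_def)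
  qed (auto simp: step_def)
next
  fix i j assume *: "(i, j) \<in> boundary B" "(i, Suc j) \<in> boundary B"
  show "step (growth F A i j) (growth F A i (Suc j))"
  proof (cases i)
    case (Suc i')
    with * have "(i', j) \<in> B" by (auto simp: boundary_def)
    then show ?thesis using assms cellD(4)[of A i' j] Suc by (auto simp: good_def)
  qed (auto simp: step_def)
qed auto

text \<open>The boundary crosses a column in a horizontal step at the top of the board, where
  \<open>col_change\<close> applies. So the nonempty columns can be read off the boundary labels
  alone.\<close>

lemma Domain_growth:
  assumes "good B A" and B: "finite B" "down_closed B"
  shows "Domain A = {i. \<exists>h. (i, h) \<in> boundary B \<and> (Suc i, h) \<in> boundary B \<and>
                            growth F A i h \<noteq> growth F A (Suc i) h}" (is "_ = ?D")
proof (intro set_eqI iffI)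
  have AB: "A \<subseteq> B" and c: "\<And>i j. (i, j) \<in> B \<Longrightarrow> cell A i j" using assms(1) by (auto simp: good_def)
  {
    fix i assume "i \<in> Domain A"
    then obtain v where v: "(i, v) \<in> A" by auto
    have "finite {h. (i, h) \<in> B}"
      by (rule finite_subset[of _ "snd ` B"]) (force intro: B(1))+
    then obtain h0 where h0: "(i, h0) \<notin> B"
      using ex_new_if_finite[of "{h. (i, h) \<in> B}"] by auto
    \<comment> \<open>The height of column \<open>i\<close> of the board, at which the boundary
      crosses the column.\<close>
    define h where "h = (LEAST h. (i, h) \<notin> B)"
    have h: "(i, h) \<notin> B" unfolding h_def using h0 by (rule LeastI)
    have less: "(i, w) \<in> B" if "w < h" for w using that not_less_Least unfolding h_def by blast
    have vh: "v < h" using v AB h down_closedD[OF B(2), of i v i h] by (metis not_less order_refl subsetD)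
    then obtain k where k: "h = Suc k" by (cases h) auto
    have "(i, h) \<in> boundary B" "(Suc i, h) \<in> boundary B"
      using h less[of k] k down_closedD[OF B(2), of i k "i - 1" k]
        down_closedD[OF B(2), of "Suc i" h i h]
      by (auto simp: boundary_def)
    moreover have "growth F A i h \<noteq> growth F A (Suc i) h"
      using col_change[of h A i] c less v vh by blast
    ultimately show "i \<in> ?D" by auto
  next
    fix i assume "i \<in> ?D"
    then obtain h where h: "(i, h) \<in> boundary B" "(Suc i, h) \<in> boundary B"
      "growth F A i h \<noteq> growth F A (Suc i) h" by auto
    have "cell A i v" if "v < h" for v
      using h(2) that down_closedD[OF B(2), of i "h - 1" i v] c[of i v] by (auto simp: boundary_def)
    then show "i \<in> Domain A" using col_change[of h A i] h(3) by auto
  }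
qed

text \<open>Induction on the board, removing a corner cell: inverting the local rule, the labels at
  three of its corners determine its entry and the label at its lower left corner, which becomes a
  boundary point of the smaller board.\<close>

lemma ex1_good:
  assumes "finite B" "down_closed B" "admissible B s"
  shows "\<exists>!A. good B A \<and> (\<forall>(i, j)\<in>boundary B. growth F A i j = s i j)"
  using assms
proof (induction "card B" arbitrary: B s rule: less_induct)
  case less
  note fin = less.prems(1) and down = less.prems(2) and adm = less.prems(3)
  show ?case
  proof (cases "B = {}")
    case True
    show ?thesis
    proof (rule ex1I[of _ "{}"])
      show "good B {} \<and> (\<forall>(i, j)\<in>boundary B. growth F {} i j = s i j)"
        using adm True unfolding good_def admissible_def boundary_def by auto
    qed (auto simp: good_def True)
  next
    case False
    \<comment> \<open>A cell of maximal coordinate sum is a corner, so deleting it leaves a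
      down-closed board.\<close>
    define M where "M = Max ((\<lambda>(i, j). i + j) ` B)"
    have "M \<in> (\<lambda>(i, j). i + j) ` B" unfolding M_def using False fin by (intro Max_in) auto
    then obtain i j where ij: "(i, j) \<in> B" "M = i + j" by auto
    have max: "u + v \<le> i + j" if "(u, v) \<in> B" for u v
    proof -
      have "u + v \<in> (\<lambda>(i, j). i + j) ` B" using that by force
      then have "u + v \<le> M" unfolding M_def using fin by (intro Max_ge) auto
      then show ?thesis using ij(2) by simp
    qed
    define B' where "B' = B - {(i, j)}"
    have lt: "card B' < card B" unfolding B'_def using fin ij by (intro psubset_card_mono) auto
    have fin': "finite B'" unfolding B'_def using fin by auto
    have down': "down_closed B'" unfolding down_closed_def
    proof (intro allI impI)
      fix a b u v assume *: "(a, b) \<in> B'" "u \<le> a" "v \<le> b"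
      then have "(u, v) \<in> B" using down_closedD[OF down] unfolding B'_def by auto
      moreover have "(u, v) \<noteq> (i, j)" using * max[of a b] unfolding B'_def by auto
      ultimately show "(u, v) \<in> B'" by (auto simp: B'_def)
    qed
    have out: "(Suc i, j) \<notin> B" "(i, Suc j) \<notin> B" "(Suc i, Suc j) \<notin> B"
      using max[of "Suc i" j] max[of i "Suc j"] max[of "Suc i" "Suc j"] by auto
    have bd: "(i, Suc j) \<in> boundary B" "(Suc i, j) \<in> boundary B" "(Suc i, Suc j) \<in> boundary B"
      using out ij down_closedD[OF down ij(1), of "i - 1" j] down_closedD[OF down ij(1), of i "j - 1"]
      by (auto simp: boundary_def)
    have bd': "boundary B' = insert (i, j) (boundary B - {(Suc i, Suc j)})"
    proof (intro set_eqI)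
      fix p :: "nat \<times> nat"
      obtain u v where p: "p = (u, v)" by fastforce
      have "(i - 1, j - 1) \<in> B'" if "i > 0" "j > 0"
        using that ij down_closedD[OF down ij(1), of "i - 1" "j - 1"] by (auto simp: B'_def)
      then show "p \<in> boundary B' \<longleftrightarrow> p \<in> insert (i, j) (boundary B - {(Suc i, Suc j)})"
        using out ij unfolding p boundary_def
        by (cases u; cases v) (auto simp: B'_def)
    qed
    let ?m = "s i (Suc j)" and ?n = "s (Suc i) j" and ?l = "s (Suc i) (Suc j)"
    have st: "step ?m ?l" "step ?n ?l"
      using admissibleD[OF adm] bd by blast+
    then obtain r e where re: "step r ?m" "step r ?n" "e \<longrightarrow> ?m = r \<and> ?n = r" "OK r ?m ?n e"
      "F r ?m ?n e = ?l" using F_ex by metis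
    define s' where "s' = (\<lambda>u v. if (u, v) = (i, j) then r else s u v)"
    \<comment> \<open>If \<open>(i, j)\<close> lies on an axis, so does one of its two neighbours;
      then \<open>r\<close> is contained in an empty partition, as admissibility on the smaller
      board requires.\<close>
    have "?m = (0, 0)" if "i = 0" using admissibleD(1)[OF adm bd(1)] that by simp
    moreover have "?n = (0, 0)" if "j = 0" using admissibleD(1)[OF adm bd(2)] that by simp
    ultimately have r0: "r = (0, 0)" if "i = 0 \<or> j = 0"
      using re(1,2) that by (cases r) (auto simp: step_def)
    have adm': "admissible B' s'"
      unfolding admissible_def
    proof (intro conjI allI impI)
      fix u v assume "(u, v) \<in> boundary B'" "u = 0 \<or> v = 0"
      then show "s' u v = (0, 0)"
        using r0 admissibleD(1)[OF adm, of u v] unfolding bd' s'_def by auto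
    next
      fix u v assume *: "(u, v) \<in> boundary B'" "(Suc u, v) \<in> boundary B'"
      \<comment> \<open>Boundary steps at the new point \<open>(i, j)\<close> only lead to the right
        and upwards: a point to its left indexes a cell of \<open>B'\<close> and is not on the
        boundary.\<close>
      have "(Suc u, v) \<noteq> (i, j)"
      proof
        assume eq: "(Suc u, v) = (i, j)"
        then have "(u, v) \<in> B'"
          using down_closedD[OF down ij(1), of u v] by (auto simp: B'_def)
        then show False using *(1) by (simp add: boundary_def)
      qed
      then show "step (s' u v) (s' (Suc u) v)"
        using * admissibleD(2)[OF adm, of u v] re(1,2) unfolding bd' s'_def by auto
    next
      fix u v assume *: "(u, v) \<in> boundary B'" "(u, Suc v) \<in> boundary B'"
      have "(u, Suc v) \<noteq> (i, j)"
      proof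
        assume eq: "(u, Suc v) = (i, j)"
        then have "(u, v) \<in> B'"
          using down_closedD[OF down ij(1), of u v] by (auto simp: B'_def)
        then show False using *(1) by (simp add: boundary_def)
      qed
      then show "step (s' u v) (s' u (Suc v))"
        using * admissibleD(3)[OF adm, of u v] re(1,2) unfolding bd' s'_def by auto
    qed
    let ?P = "\<lambda>A. good B A \<and> (\<forall>(u, v)\<in>boundary B. growth F A u v = s u v)"
    let ?Q = "\<lambda>A. good B' A \<and> (\<forall>(u, v)\<in>boundary B'. growth F A u v = s' u v)"
    have ex1: "\<exists>!A. ?Q A" by (rule less.hyps[OF lt fin' down' adm'])
    define A0 where "A0 = The ?Q"
    have A0: "?Q A0" unfolding A0_def by (rule theI'[OF ex1])
    have uniq: "A = A0" if "?Q A" for A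
      unfolding A0_def using the1_equality[OF ex1 that] by simp
    have mem: "p \<in> A \<longleftrightarrow> p \<in> A'" if "A - {(i, j)} = A' - {(i, j)}" "p \<noteq> (i, j)"
      for A A' :: "(nat \<times> nat) set" and p using that by blast
    \<comment> \<open>The entry of the removed cell influences only labels strictly above and to the
      right of \<open>(i, j)\<close>, and by \<open>le\<close> below no boundary point of
      \<open>B'\<close> lies there.\<close>
    have cg: "growth F A u v = growth F A' u v"
      if "A - {(i, j)} = A' - {(i, j)}" "u \<le> i \<or> v \<le> j" for A A' :: "(nat \<times> nat) set" and u v
      by (rule growth_cong, rule mem[OF that(1)]) (use that(2) in auto)
    have le: "u \<le> i \<or> v \<le> j" if "(u, v) \<in> boundary B'" for u v
    proof (rule ccontr)
      assume "\<not> (u \<le> i \<or> v \<le> j)"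
      then have "(i, j) \<in> B'"
        using that down_closedD[OF down', of "u - 1" "v - 1" i j] by (auto simp: boundary_def)
      then show False by (auto simp: B'_def)
    qed
    have le2: "\<not> (i \<le> u \<and> j \<le> v)" if "(u, v) \<in> B'" for u v
      using that down_closedD[OF down' that, of i j] by (auto simp: B'_def)
    have cl: "cell A u v = cell A' u v"
      if "A - {(i, j)} = A' - {(i, j)}" "(u, v) \<in> B'" for A A' u v
      by (rule cell_cong, rule mem[OF that(1)]) (use le2[OF that(2)] in auto)
    have ij': "(i, j) \<in> boundary B'" "(i, Suc j) \<in> boundary B'" "(Suc i, j) \<in> boundary B'"
      using bd bd' by auto
    \<comment> \<open>Existence and uniqueness in one equivalence: the filling is the unique filling
      \<open>A0\<close> of the smaller board, with the removed cell filled as \<open>e\<close>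
      prescribes.\<close>
    have key: "?P A \<longleftrightarrow> A = A0 \<union> (if e then {(i, j)} else {})" for A
    proof
      assume P: "?P A"
      let ?A = "A - {(i, j)}"
      have c: "cell A i j" using P ij by (auto simp: good_def)
      have mn: "growth F A i (Suc j) = ?m" "growth F A (Suc i) j = ?n"
        "growth F A (Suc i) (Suc j) = ?l" using P bd by auto
      have "growth F A i j = r \<and> ((i, j) \<in> A) = e"
        using c mn re by (intro F_inj[of _ ?m ?n]) (auto simp: cell_def fits_def)
      moreover have "?Q ?A"
      proof
        have "cell ?A u v" if "(u, v) \<in> B'" for u v
          using cl[of ?A A, OF _ that] P that by (auto simp: good_def B'_def)
        then show "good B' ?A"
          using P unfolding good_def B'_def by auto
        have "growth F ?A u v = s' u v" if "(u, v) \<in> boundary B'" for u v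
          using P that bd' le[OF that] cg[of ?A A u v] \<open>growth F A i j = r \<and> ((i, j) \<in> A) = e\<close>
          by (auto simp: s'_def)
        then show "\<forall>(u, v)\<in>boundary B'. growth F ?A u v = s' u v" by auto
      qed
      ultimately show "A = A0 \<union> (if e then {(i, j)} else {})"
        using uniq[of ?A] by auto
    next
      assume A: "A = A0 \<union> (if e then {(i, j)} else {})"
      have "(i, j) \<notin> A0" using A0 by (auto simp: good_def B'_def)
      then have AA: "A - {(i, j)} = A0 - {(i, j)}" and ijA: "(i, j) \<in> A \<longleftrightarrow> e" using A by auto
      have g: "growth F A u v = s' u v" if "(u, v) \<in> boundary B'" for u v
        using A0 that cg[OF AA le[OF that]] by auto
      have mn: "growth F A i j = r" "growth F A i (Suc j) = ?m" "growth F A (Suc i) j = ?n"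
        using g[OF ij'(1)] g[OF ij'(2)] g[OF ij'(3)] by (auto simp: s'_def)
      then have l: "growth F A (Suc i) (Suc j) = ?l" using re ijA by auto
      have "cell A i j" unfolding cell_def fits_def using mn re ijA by auto
      moreover have "cell A u v" if "(u, v) \<in> B'" for u v
        using cl[OF AA that] A0 that by (auto simp: good_def)
      ultimately have "cell A u v" if "(u, v) \<in> B" for u v
        using that by (cases "(u, v) = (i, j)") (auto simp: B'_def)
      then have "good B A"
        using A0 ij A unfolding good_def B'_def by auto
      moreover have "growth F A u v = s u v" if uv: "(u, v) \<in> boundary B" for u v
      proof (cases "(u, v) = (Suc i, Suc j)")
        case True
        then show ?thesis using l by simp
      next
        case False
        then have "(u, v) \<in> boundary B'" using uv bd' by auto
        moreover have "(u, v) \<noteq> (i, j)" using uv ij by (auto simp: boundary_def)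
        ultimately show ?thesis using g[of u v] by (auto simp: s'_def)
      qed
      ultimately show "?P A" by auto
    qed
    show ?thesis unfolding key by auto
  qed
qed

end

section \<open>Comparing two local rules on a symmetric board\<close>

lemma boundary_converse: "(i, j) \<in> boundary (B\<inverse>) \<longleftrightarrow> (j, i) \<in> boundary B"
  by (auto simp: boundary_def)

text \<open>A filling for the first rule is sent to the filling for the second with the same
  boundary labels; this is injective because the labels determine the filling. An inequality
  suffices, since the two rules can be swapped.\<close>

lemma card_good_le:
  assumes "local_rule F OK" "local_rule F' OK'"
    and B: "finite B" "down_closed B" "sym B"
  shows "card {A. local_rule.good F OK B A \<and> sym A \<and> Domain A = D}
       \<le> card {A. local_rule.good F' OK' B A \<and> sym A \<and> Domain A = D}"
proof -
  interpret r1: local_rule F OK by fact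
  interpret r2: local_rule F' OK' by fact
  let ?X = "{A. r1.good B A \<and> sym A \<and> Domain A = D}"
  let ?Y = "{A. r2.good B A \<and> sym A \<and> Domain A = D}"
  let ?eq = "\<lambda>A A'. \<forall>(i, j)\<in>boundary B. growth F' A' i j = growth F A i j"
  have ex: "\<exists>A'. A' \<in> ?Y \<and> ?eq A A'" if A: "A \<in> ?X" for A
  proof -
    have r1: "r1.good B A" using A by simp
    define Q where "Q A' \<longleftrightarrow> r2.good B A' \<and> ?eq A A'" for A'
    have ex1: "\<exists>!A'. Q A'"
      unfolding Q_def using A r1.good_admissible by (intro r2.ex1_good B) auto
    define A' where "A' = The Q"
    have "Q A'" unfolding A'_def by (rule theI'[OF ex1])
    then have A': "r2.good B A'" "?eq A A'" by (auto simp only: Q_def)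
    have u: "A'' = A'" if "r2.good B A''" "?eq A A''" for A''
    proof -
      have "Q A''" using that by (simp only: Q_def)
      then show ?thesis unfolding A'_def by (rule the1_equality[OF ex1, symmetric])
    qed
    have Bc: "B\<inverse> = B" and Ac: "A\<inverse> = A" using B(3) A by (auto simp: sym_conv_converse_eq)
    \<comment> \<open>The boundary labels of the symmetric filling \<open>A\<close> are symmetric,
      so \<open>A'\<close> and its transpose share them, and uniqueness applies.\<close>
    have "A'\<inverse> = A'"
    proof (rule u)
      show "r2.good B (A'\<inverse>)" using r2.good_converse[OF A'(1)] Bc by simp
      show "?eq A (A'\<inverse>)"
      proof safe
        fix i j assume "(i, j) \<in> boundary B"
        then have "(j, i) \<in> boundary B" using boundary_converse[of j i B] Bc by simp
        then show "growth F' (A'\<inverse>) i j = growth F A i j"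
          using A'(2) r1.growth_converse[of A i j] Ac by (auto simp: r2.growth_converse)
      qed
    qed
    moreover have eq: "growth F' A' i j = growth F A i j" if "(i, j) \<in> boundary B" for i j
      using A'(2) that by auto
    have "Domain A' = Domain A"
      unfolding r2.Domain_growth[OF A'(1) B(1,2)] r1.Domain_growth[OF r1 B(1,2)]
      by (simp add: eq cong: conj_cong)
    ultimately show ?thesis using A A' by (auto simp: sym_conv_converse_eq)
  qed
  define f where "f A = (SOME A'. A' \<in> ?Y \<and> ?eq A A')" for A
  have f: "f A \<in> ?Y \<and> ?eq A (f A)" if "A \<in> ?X" for A
    unfolding f_def by (rule someI_ex[OF ex[OF that]])
  have "inj_on f ?X"
  proof
    fix A1 A2 assume *: "A1 \<in> ?X" "A2 \<in> ?X" "f A1 = f A2"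
    have "\<forall>(i, j)\<in>boundary B. growth F A2 i j = growth F A1 i j"
      using conjunct2[OF f[OF *(1)]] conjunct2[OF f[OF *(2)]] *(3) by fastforce
    moreover have ex1: "\<exists>!A. r1.good B A \<and> (\<forall>(i, j)\<in>boundary B. growth F A i j = growth F A1 i j)"
      using *(1) by (intro r1.ex1_good B r1.good_admissible) auto
    ultimately show "A1 = A2"
      by (intro trans[OF the1_equality[OF ex1, symmetric] the1_equality[OF ex1]]) (use * in auto)
  qed
  moreover have "f ` ?X \<subseteq> ?Y" using f by blast
  moreover have "finite ?Y"
    by (rule finite_subset[of _ "Pow B"]) (auto simp: r2.good_def B(1))
  ultimately show ?thesis by (rule card_inj_on_le)
qed

section \<open>The two local rules\<close>

text \<open>
  Both rules are the local rule of the Robinson-Schensted correspondence. Partitions with at most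
  two rows forbid the step in which a box would be bumped into the third row; partitions with at
  most two columns forbid an entry that would make the first row longer than two.
\<close>

definition rule321 :: "label \<Rightarrow> label \<Rightarrow> label \<Rightarrow> bool \<Rightarrow> label" where
  "rule321 r m n e =
     (if e then (Suc (fst r), snd r)
      else if m = n \<and> m \<noteq> r then (fst m, Suc (snd m))
      else (max (fst m) (fst n), max (snd m) (snd n)))"

definition ok321 :: "label \<Rightarrow> label \<Rightarrow> label \<Rightarrow> bool \<Rightarrow> bool" where
  "ok321 r m n e \<longleftrightarrow> \<not> (m = n \<and> m \<noteq> r \<and> fst m = fst r)"

text \<open>The backward rule, recovering \<open>(r, e)\<close>. When \<open>m = n\<close> differs
  from \<open>l\<close>, a box gained in the first row stems from an entry, and a box gained in the
  second row was bumped from the first.\<close>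

definition inv321 :: "label \<Rightarrow> label \<Rightarrow> label \<Rightarrow> label \<times> bool" where
  "inv321 m n l =
     (if m = l then (n, False)
      else if n = l then (m, False)
      else if m \<noteq> n then ((min (fst m) (fst n), min (snd m) (snd n)), False)
      else if fst l \<noteq> fst m then (m, True)
      else ((fst m - 1, snd m), False))"

text \<open>In column lengths: an entry puts a box at the end of the first row, and a box added in
  both \<open>m\<close> and \<open>n\<close> is bumped into the next row. There it lands in the
  second column if the row already has a box; otherwise it begins a new row.\<close>

definition rule123 :: "label \<Rightarrow> label \<Rightarrow> label \<Rightarrow> bool \<Rightarrow> label" where
  "rule123 r m n e =
     (if e then (if fst r = 0 then (1, 0) else (fst r, 1))
      else if m = n \<and> m \<noteq> r then
        (if fst m = fst r \<and> snd m < fst m then (fst m, Suc (snd m)) else (Suc (fst m), snd m))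
      else (max (fst m) (fst n), max (snd m) (snd n)))"

definition ok123 :: "label \<Rightarrow> label \<Rightarrow> label \<Rightarrow> bool \<Rightarrow> bool" where
  "ok123 r m n e \<longleftrightarrow> (e \<longrightarrow> snd r = 0)"

text \<open>The backward rule. When \<open>m = n\<close> differs from \<open>l\<close>, a gain in
  the first column comes from that column unless both columns of \<open>m\<close> are equally long.
  Otherwise the box was bumped from the second column, or, if that column is empty, the gain is due
  to an entry.\<close>

definition inv123 :: "label \<Rightarrow> label \<Rightarrow> label \<Rightarrow> label \<times> bool" where
  "inv123 m n l =
     (if m = l then (n, False)
      else if n = l then (m, False)
      else if m \<noteq> n then ((min (fst m) (fst n), min (snd m) (snd n)), False)
      else if fst l \<noteq> fst m \<and> snd m < fst m then ((fst m - 1, snd m), False)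
      else if snd m = 0 then (m, True)
      else ((fst m, snd m - 1), False))"

lemma stepE:
  assumes "step p q"
  obtains a b where "p = (a, b)" "q = (a, b)" "b \<le> a"
  | a b where "p = (a, b)" "q = (Suc a, b)" "b \<le> a"
  | a b where "p = (a, b)" "q = (a, Suc b)" "b < a"
  using assms by (cases p; cases q) (auto simp: step_def)

text \<open>The last conclusion, that the backward rule undoes the forward rule, yields
  \<open>F_inj\<close>; its counterpart \<open>rule321_inv\<close> yields
  \<open>F_ex\<close>.\<close>

lemma rule321_step:
  assumes "step r m" "step r n" "e \<longrightarrow> m = r \<and> n = r" "ok321 r m n e"
  shows "step m (rule321 r m n e)" "m = rule321 r m n e \<longleftrightarrow> r = n \<and> \<not> e"
    "inv321 m n (rule321 r m n e) = (r, e)"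
  using assms(3,4)
  by (cases rule: stepE[OF assms(1)]; cases rule: stepE[OF assms(2)]; cases e;
      simp add: step_def rule321_def ok321_def inv321_def)+

lemma rule321_inv:
  assumes "step m l" "step n l" "inv321 m n l = (r, e)"
  shows "step r m \<and> step r n \<and> (e \<longrightarrow> m = r \<and> n = r) \<and> ok321 r m n e \<and> rule321 r m n e = l"
  using assms(3)
  by (cases rule: stepE[OF assms(1)]; cases rule: stepE[OF assms(2)])
     (auto simp: step_def rule321_def ok321_def inv321_def)

lemma rule123_step:
  assumes "step r m" "step r n" "e \<longrightarrow> m = r \<and> n = r" "ok123 r m n e"
  shows "step m (rule123 r m n e)" "m = rule123 r m n e \<longleftrightarrow> r = n \<and> \<not> e"
    "inv123 m n (rule123 r m n e) = (r, e)"
  using assms(3,4)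
  by (cases rule: stepE[OF assms(1)]; cases rule: stepE[OF assms(2)]; cases e;
      auto simp: step_def rule123_def ok123_def inv123_def split: if_splits)+

lemma rule123_inv:
  assumes "step m l" "step n l" "inv123 m n l = (r, e)"
  shows "step r m \<and> step r n \<and> (e \<longrightarrow> m = r \<and> n = r) \<and> ok123 r m n e \<and> rule123 r m n e = l"
  using assms(3)
  by (cases rule: stepE[OF assms(1)]; cases rule: stepE[OF assms(2)])
     (auto simp: step_def rule123_def ok123_def inv123_def split: if_splits)

interpretation r321: local_rule rule321 ok321
proof
  show "\<exists>r e. step r m \<and> step r n \<and> (e \<longrightarrow> m = r \<and> n = r) \<and> ok321 r m n e \<and> rule321 r m n e = l"
    if "step m l" "step n l" for m l n
    using rule321_inv[OF that] by (metis surj_pair)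
  show "r = r' \<and> e = e'"
    if "step r m" "step r n" "e \<Longrightarrow> m = r \<and> n = r" "ok321 r m n e"
      "step r' m" "step r' n" "e' \<Longrightarrow> m = r' \<and> n = r'" "ok321 r' m n e'"
      "rule321 r m n e = rule321 r' m n e'" for r m n e r' e'
  proof -
    have 1: "inv321 m n (rule321 r m n e) = (r, e)"
      by (rule rule321_step(3)[OF that(1,2) _ that(4)]) (use that(3) in blast)
    have 2: "inv321 m n (rule321 r' m n e') = (r', e')"
      by (rule rule321_step(3)[OF that(5,6) _ that(8)]) (use that(7) in blast)
    have "(r, e) = (r', e')"
      by (rule trans[OF 1[symmetric] 2[folded that(9)]])
    then show ?thesis by (rule Pair_inject) (rule conjI)
  qed
next
  show "step m (rule321 r m n e) \<and> (m = rule321 r m n e \<longleftrightarrow> r = n \<and> \<not> e)"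
    if "step r m" "step r n" "e \<Longrightarrow> m = r \<and> n = r" "ok321 r m n e" for r m n e
  proof -
    have "e \<longrightarrow> m = r \<and> n = r" using that(3) by blast
    from rule321_step(1,2)[OF that(1,2) this that(4)] show ?thesis by (rule conjI)
  qed
qed (auto simp: rule321_def ok321_def max.commute)

interpretation r123: local_rule rule123 ok123
proof
  show "\<exists>r e. step r m \<and> step r n \<and> (e \<longrightarrow> m = r \<and> n = r) \<and> ok123 r m n e \<and> rule123 r m n e = l"
    if "step m l" "step n l" for m l n
    using rule123_inv[OF that] by (metis surj_pair)
  show "r = r' \<and> e = e'"
    if "step r m" "step r n" "e \<Longrightarrow> m = r \<and> n = r" "ok123 r m n e"
      "step r' m" "step r' n" "e' \<Longrightarrow> m = r' \<and> n = r'" "ok123 r' m n e'"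
      "rule123 r m n e = rule123 r' m n e'" for r m n e r' e'
  proof -
    have 1: "inv123 m n (rule123 r m n e) = (r, e)"
      by (rule rule123_step(3)[OF that(1,2) _ that(4)]) (use that(3) in blast)
    have 2: "inv123 m n (rule123 r' m n e') = (r', e')"
      by (rule rule123_step(3)[OF that(5,6) _ that(8)]) (use that(7) in blast)
    have "(r, e) = (r', e')"
      by (rule trans[OF 1[symmetric] 2[folded that(9)]])
    then show ?thesis by (rule Pair_inject) (rule conjI)
  qed
next
  show "step m (rule123 r m n e) \<and> (m = rule123 r m n e \<longleftrightarrow> r = n \<and> \<not> e)"
    if "step r m" "step r n" "e \<Longrightarrow> m = r \<and> n = r" "ok123 r m n e" for r m n e
  proof -
    have "e \<longrightarrow> m = r \<and> n = r" using that(3) by blast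
    from rule123_step(1,2)[OF that(1,2) this that(4)] show ?thesis by (rule conjI)
  qed
qed (auto simp: rule123_def ok123_def max.commute)

section \<open>Growth diagrams and avoidance\<close>

definition has123 :: "(nat \<times> nat) set \<Rightarrow> bool" where
  "has123 A \<longleftrightarrow> (\<exists>i1 j1 i2 j2 i3 j3. (i1, j1) \<in> A \<and> (i2, j2) \<in> A \<and> (i3, j3) \<in> A \<and>
     i1 < i2 \<and> i2 < i3 \<and> j1 < j2 \<and> j2 < j3)"

text \<open>
  The rectangle spanned by an occurrence has to lie in the board. For \<open>123\<close> this is automatic,
  since the upper right corner of the rectangle is itself an entry.
\<close>

definition has321 :: "(nat \<times> nat) set \<Rightarrow> (nat \<times> nat) set \<Rightarrow> bool" where
  "has321 B A \<longleftrightarrow> (\<exists>i1 j1 i2 j2 i3 j3. (i1, j1) \<in> A \<and> (i2, j2) \<in> A \<and> (i3, j3) \<in> A \<and>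
     i1 < i2 \<and> i2 < i3 \<and> j1 > j2 \<and> j2 > j3 \<and> (i3, j1) \<in> B)"

section \<open>Forbidden cells of \<open>rule123\<close> and the pattern 123\<close>

lemma rule123_pos:
  assumes "r123.fits r m n e"
  shows "fst (rule123 r m n e) > 0 \<longleftrightarrow> e \<or> fst m > 0 \<or> fst n > 0"
    and "snd (rule123 r m n e) > 0 \<longleftrightarrow> e \<and> fst r > 0 \<or> snd m > 0 \<or> snd n > 0"
proof -
  have st: "step r m" "step r n" and *: "e \<longrightarrow> m = r \<and> n = r" "ok123 r m n e"
    using assms by (auto simp: r123.fits_def)
  show "fst (rule123 r m n e) > 0 \<longleftrightarrow> e \<or> fst m > 0 \<or> fst n > 0"
    "snd (rule123 r m n e) > 0 \<longleftrightarrow> e \<and> fst r > 0 \<or> snd m > 0 \<or> snd n > 0"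
    using *
    by (cases rule: stepE[OF st(1)]; cases rule: stepE[OF st(2)]; cases e;
        simp add: rule123_def ok123_def)+
qed

text \<open>\<open>ok123\<close> only asks whether the second part vanishes, so it is enough to
  track when the parts become positive.\<close>

lemma growth123_fst_pos:
  assumes "\<And>u v. u < i \<Longrightarrow> v < j \<Longrightarrow> r123.cell A u v"
  shows "fst (growth rule123 A i j) > 0 \<longleftrightarrow> (\<exists>u v. (u, v) \<in> A \<and> u < i \<and> v < j)"
  using assms
proof (induction "i + j" arbitrary: i j rule: less_induct)
  case less
  show ?case
  proof (cases "i = 0 \<or> j = 0")
    case False
    then obtain i' j' where ij: "i = Suc i'" "j = Suc j'" by (auto simp: gr0_conv_Suc)
    have c: "r123.cell A i' j'" using less.prems ij by auto
    have "fst (growth rule123 A i j) > 0 \<longleftrightarrow>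
      (i', j') \<in> A \<or> fst (growth rule123 A i' j) > 0 \<or> fst (growth rule123 A i j') > 0"
      using c unfolding r123.cell_def ij growth.simps by (rule rule123_pos(1))
    also have "\<dots> \<longleftrightarrow> (i', j') \<in> A \<or> (\<exists>u v. (u, v) \<in> A \<and> u < i' \<and> v < j) \<or>
        (\<exists>u v. (u, v) \<in> A \<and> u < i \<and> v < j')"
      using less.hyps[of i' j] less.hyps[of i j'] less.prems ij by auto
    also have "\<dots> \<longleftrightarrow> (\<exists>u v. (u, v) \<in> A \<and> u < i \<and> v < j)"
      unfolding ij less_Suc_eq by blast
    finally show ?thesis .
  qed auto
qed

text \<open>A nonempty second column means a first row of length two, that is, an increasing pair;
  it first arises when an entry meets a nonempty partition.\<close>

lemma growth123_snd_pos:
  assumes "\<And>u v. u < i \<Longrightarrow> v < j \<Longrightarrow> r123.cell A u v"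
  shows "snd (growth rule123 A i j) > 0 \<longleftrightarrow>
    (\<exists>u v u' v'. (u, v) \<in> A \<and> (u', v') \<in> A \<and> u < u' \<and> v < v' \<and> u' < i \<and> v' < j)"
  using assms
proof (induction "i + j" arbitrary: i j rule: less_induct)
  case less
  show ?case
  proof (cases "i = 0 \<or> j = 0")
    case False
    then obtain i' j' where ij: "i = Suc i'" "j = Suc j'" by (auto simp: gr0_conv_Suc)
    have c: "r123.cell A i' j'" using less.prems ij by auto
    have f: "fst (growth rule123 A i' j') > 0 \<longleftrightarrow> (\<exists>u v. (u, v) \<in> A \<and> u < i' \<and> v < j')"
      using less.prems ij by (intro growth123_fst_pos) auto
    have "snd (growth rule123 A i j) > 0 \<longleftrightarrow>
      (i', j') \<in> A \<and> fst (growth rule123 A i' j') > 0 \<or>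
      snd (growth rule123 A i' j) > 0 \<or> snd (growth rule123 A i j') > 0"
      using c unfolding r123.cell_def ij growth.simps by (rule rule123_pos(2))
    also have "\<dots> \<longleftrightarrow> (i', j') \<in> A \<and> (\<exists>u v. (u, v) \<in> A \<and> u < i' \<and> v < j') \<or>
        (\<exists>u v u' v'. (u, v) \<in> A \<and> (u', v') \<in> A \<and> u < u' \<and> v < v' \<and> u' < i' \<and> v' < j) \<or>
        (\<exists>u v u' v'. (u, v) \<in> A \<and> (u', v') \<in> A \<and> u < u' \<and> v < v' \<and> u' < i \<and> v' < j')"
      unfolding f using less.hyps[of i' j] less.hyps[of i j'] less.prems ij by auto
    also have "\<dots> \<longleftrightarrow>
        (\<exists>u v u' v'. (u, v) \<in> A \<and> (u', v') \<in> A \<and> u < u' \<and> v < v' \<and> u' < i \<and> v' < j)"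
      (is "?l \<longleftrightarrow> ?r")
    proof
      show "?l \<Longrightarrow> ?r" unfolding ij less_Suc_eq by blast
      assume ?r
      then obtain u v u' v' where *: "(u, v) \<in> A" "(u', v') \<in> A" "u < u'" "v < v'" "u' < i" "v' < j"
        by blast
      then consider "u' = i'" "v' = j'" | "u' < i'" | "v' < j'" unfolding ij by linarith
      then show ?l by cases (use * in blast)+
    qed
    finally show ?thesis .
  qed auto
qed

text \<open>A cell forbidden by \<open>ok123\<close> holds an entry above and to the right of an
  increasing pair, hence the last entry of a \<open>123\<close>. The rectangle below that entry lies
  in the board by down-closure.\<close>

lemma good123_iff:
  assumes "down_closed B"
  shows "r123.good B A \<longleftrightarrow> A \<subseteq> B \<and> partial_perm A \<and> \<not> has123 A"
proof (intro iffI conjI)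
  assume good: "r123.good B A"
  then show AB: "A \<subseteq> B" by (simp add: r123.good_def)
  show "partial_perm A" using good assms by (rule r123.good_partial_perm)
  show "\<not> has123 A"
  proof
    assume "has123 A"
    then obtain i1 j1 i2 j2 i3 j3 where *: "(i1, j1) \<in> A" "(i2, j2) \<in> A" "(i3, j3) \<in> A"
      "i1 < i2" "i2 < i3" "j1 < j2" "j2 < j3" unfolding has123_def by blast
    have c: "r123.cell A u v" if "u \<le> i3" "v \<le> j3" for u v
      using good AB *(3) that down_closedD[OF assms, of i3 j3 u v] by (auto simp: r123.good_def)
    have "snd (growth rule123 A i3 j3) > 0"
      by (subst growth123_snd_pos) (use * c in \<open>fastforce+\<close>)
    then show False using r123.cellD(9)[OF c[of i3 j3]] *(3) by (simp add: ok123_def)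
  qed
next
  assume *: "A \<subseteq> B \<and> partial_perm A \<and> \<not> has123 A"
  show "r123.good B A"
  proof (rule r123.goodI[OF assms])
    fix i j assume "(i, j) \<in> B"
      and c: "\<And>u v. u \<le> i \<Longrightarrow> v \<le> j \<Longrightarrow> (u, v) \<noteq> (i, j) \<Longrightarrow> r123.cell A u v"
    have s: "snd (growth rule123 A i j) > 0 \<longleftrightarrow>
      (\<exists>u v u' v'. (u, v) \<in> A \<and> (u', v') \<in> A \<and> u < u' \<and> v < v' \<and> u' < i \<and> v' < j)"
      by (rule growth123_snd_pos) (rule c, auto)
    show "ok123 (growth rule123 A i j) (growth rule123 A i (Suc j))
      (growth rule123 A (Suc i) j) ((i, j) \<in> A)"
      unfolding ok123_def
    proof
      assume "(i, j) \<in> A"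
      then have "\<not> snd (growth rule123 A i j) > 0"
        using * unfolding s has123_def by blast
      then show "snd (growth rule123 A i j) = 0" by simp
    qed
  qed (use * in auto)
qed

text \<open>
  For the rule \<open>rule321\<close> the first part of the label at \<open>(i, j)\<close> is the length of a longest
  increasing chain of \<open>A\<close> in \<open>{..<i} \<times> {..<j}\<close>, whether or not forbidden cells occur.
\<close>

definition lis :: "(nat \<times> nat) set \<Rightarrow> nat \<Rightarrow> nat \<Rightarrow> nat" where
  "lis A i j = fst (growth rule321 A i j)"

lemma lis_0 [simp]: "lis A 0 j = 0" "lis A i 0 = 0"
  by (simp_all add: lis_def)

lemma lis_Suc_Suc:
  "lis A (Suc i) (Suc j) =
     (if (i, j) \<in> A then Suc (lis A i j) else max (lis A i (Suc j)) (lis A (Suc i) j))"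
  by (auto simp: lis_def rule321_def)

lemma lis_converse: "lis (A\<inverse>) j i = lis A i j"
  by (simp add: lis_def r321.growth_converse)

lemma lis_step:
  "lis A i j \<le> lis A (Suc i) j \<and> lis A (Suc i) j \<le> Suc (lis A i j) \<and>
   lis A i j \<le> lis A i (Suc j) \<and> lis A i (Suc j) \<le> Suc (lis A i j)"
proof (induction "i + j" arbitrary: i j rule: less_induct)
  case less
  have "lis A i j \<le> lis A (Suc i) j \<and> lis A (Suc i) j \<le> Suc (lis A i j)"
  proof (cases j)
    case (Suc j')
    then show ?thesis using less[of i j'] by (auto simp: lis_Suc_Suc)
  qed simp
  moreover have "lis A i j \<le> lis A i (Suc j) \<and> lis A i (Suc j) \<le> Suc (lis A i j)"
  proof (cases i)
    case (Suc i')
    then show ?thesis using less[of i' j] by (auto simp: lis_Suc_Suc)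
  qed simp
  ultimately show ?case by simp
qed

lemma lis_mono: "i \<le> i' \<Longrightarrow> j \<le> j' \<Longrightarrow> lis A i j \<le> lis A i' j'"
  using lift_Suc_mono_le[of "\<lambda>i. lis A i j" i i'] lift_Suc_mono_le[of "\<lambda>j. lis A i' j" j j']
    lis_step by (meson order_trans)

lemma lis_le: "(u, v) \<in> A \<Longrightarrow> u < i \<Longrightarrow> v < j \<Longrightarrow> Suc (lis A u v) \<le> lis A i j"
  using lis_mono[of "Suc u" i "Suc v" j A] by (simp add: lis_Suc_Suc)

lemma lis_top:
  assumes "lis A i j > 0"
  shows "\<exists>u v. (u, v) \<in> A \<and> u < i \<and> v < j \<and> Suc (lis A u v) = lis A i j"
  using assms
proof (induction "i + j" arbitrary: i j rule: less_induct)
  case less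
  then obtain i' j' where ij: "i = Suc i'" "j = Suc j'" by (cases i; cases j) auto
  consider "(i', j') \<in> A" | "(i', j') \<notin> A" "lis A i j = lis A i' j" |
    "(i', j') \<notin> A" "lis A i j = lis A i j'"
    unfolding ij lis_Suc_Suc max_def by meson
  then show ?case
  proof cases
    case 1
    then show ?thesis unfolding ij by (auto simp: lis_Suc_Suc)
  next
    case 2
    then show ?thesis using less.hyps[of i' j] less.prems ij by fastforce
  next
    case 3
    then show ?thesis using less.hyps[of i j'] less.prems ij by fastforce
  qed
qed

text \<open>The increase is due to an entry of row \<open>j\<close> that ends a longest chain, so a
  chain to its lower left already has the full previous length.\<close>

lemma lis_row:
  assumes "lis A i (Suc j) \<noteq> lis A i j"
  shows "\<exists>c<i. (c, j) \<in> A \<and> lis A c j = lis A i j"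
  using assms
proof (induction i)
  case (Suc i)
  show ?case
  proof (cases "(i, j) \<in> A")
    case True
    then have "lis A i j = lis A (Suc i) j"
      using Suc.prems lis_step[of A i j] lis_step[of A "Suc i" j] by (simp add: lis_Suc_Suc)
    then show ?thesis using True by auto
  next
    case False
    then have "lis A i (Suc j) > lis A (Suc i) j"
      using Suc.prems by (auto simp: lis_Suc_Suc max_def split: if_splits)
    then have "lis A (Suc i) j = lis A i j" "lis A i (Suc j) \<noteq> lis A i j"
      using lis_step[of A i j] by auto
    then show ?thesis using Suc.IH less_SucI by metis
  qed
qed simp

lemma partial_permD:
  assumes "partial_perm A"
  shows "(i, j) \<in> A \<Longrightarrow> (i, j') \<in> A \<Longrightarrow> j = j'" "(i, j) \<in> A \<Longrightarrow> (i', j) \<in> A \<Longrightarrow> i = i'"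
  using assms unfolding partial_perm_def single_valued_def by blast+

lemma partial_perm_converse: "partial_perm A \<Longrightarrow> partial_perm (A\<inverse>)"
  by (auto simp: partial_perm_def)

text \<open>If row \<open>j\<close> raised the length, \<open>(c, j)\<close> would end a longest
  chain. The previous entry of that chain lies to the left of column \<open>c\<close>. If it were
  below row \<open>v\<close>, a chain through \<open>(u, v)\<close> would be too long; if it were
  above, it would contradict \<open>min\<close>.\<close>

lemma lis_no_raise:
  assumes A: "partial_perm A" and p: "(c, j) \<in> A" "(u, v) \<in> A"
    and lt: "c < u" "u < i" "v < j"
    and min: "\<And>u' v'. (u', v') \<in> A \<Longrightarrow> u' < u \<Longrightarrow> v < v' \<Longrightarrow> v' < j \<Longrightarrow> False"
  shows "lis A i (Suc j) = lis A i j"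
proof (rule ccontr)
  assume "lis A i (Suc j) \<noteq> lis A i j"
  then obtain c' where "(c', j) \<in> A" "lis A c' j = lis A i j" using lis_row by blast
  then have L: "lis A c j = lis A i j" using partial_permD(2)[OF A p(1)] by metis
  have uv: "Suc (lis A u v) \<le> lis A i j" using lis_le p(2) lt by blast
  then obtain u' v' where *: "(u', v') \<in> A" "u' < c" "v' < j" "Suc (lis A u' v') = lis A c j"
    using L lis_top[of A c j] by auto
  have "\<not> v' < v" using lis_le[of u' v' A u v] * lt L uv by auto
  moreover have "v' \<noteq> v" using partial_permD(2)[OF A *(1), of u] p(2) * lt by auto
  ultimately show False using min[OF *(1)] * lt by simp
qed

text \<open>At a forbidden cell \<open>(i, j)\<close>, row \<open>j\<close> and column
  \<open>i\<close> already contain entries to the left and below, but neither lengthens the longest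
  increasing chain. A \<open>321\<close> with minimal corner cell produces such a cell, and each
  such cell completes a \<open>321\<close>.\<close>

lemma good321_iff:
  assumes B: "down_closed B"
  shows "r321.good B A \<longleftrightarrow> A \<subseteq> B \<and> partial_perm A \<and> \<not> has321 B A"
proof (intro iffI conjI)
  assume good: "r321.good B A"
  then show AB: "A \<subseteq> B" by (simp add: r321.good_def)
  show pp: "partial_perm A" using good assms by (rule r321.good_partial_perm)
  \<comment> \<open>A \<open>321\<close> whose rectangle has the corner cell \<open>(i, j)\<close>.
    Minimality of \<open>i + j\<close> supplies the last hypothesis of \<open>lis_no_raise\<close>,
    for row \<open>j\<close> and, after transposition, for column \<open>i\<close>.\<close>
  let ?Q = "\<lambda>c u v b i j. (c, j) \<in> A \<and> (u, v) \<in> A \<and> (i, b) \<in> A \<and>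
    c < u \<and> u < i \<and> b < v \<and> v < j \<and> (i, j) \<in> B"
  have "\<not> ?Q c u v b i j" for c u v b i j
  proof (induction "i + j" arbitrary: c u v b i j rule: less_induct)
    case less
    show ?case
    proof
      assume Q: "?Q c u v b i j"
      have c: "r321.cell A u v" if "u \<le> i" "v \<le> j" for u v
        using good Q that down_closedD[OF B, of i j u v] by (auto simp: r321.good_def)
      have ch: "growth rule321 A i j \<noteq> growth rule321 A i (Suc j)"
        "growth rule321 A i j \<noteq> growth rule321 A (Suc i) j"
        using r321.row_change[of i A j] r321.col_change[of j A i] c Q by auto
      have "lis A i (Suc j) = lis A i j"
      proof (rule lis_no_raise[OF pp, of c j u v])
        fix u' v' assume "(u', v') \<in> A" "u' < u" "v < v'" "v' < j"
        then show False
          using less.hyps[of i v' u' u v b] Q down_closedD[OF B, of i j i v'] by auto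
      qed (use Q in auto)
      moreover have "lis (A\<inverse>) j (Suc i) = lis (A\<inverse>) j i"
      proof (rule lis_no_raise[OF partial_perm_converse[OF pp], of b i v u])
        fix v' u' assume "(v', u') \<in> A\<inverse>" "v' < v" "u < u'" "u' < i"
        then show False
          using less.hyps[of u' j c u v v'] Q down_closedD[OF B, of i j u' j] by auto
      qed (use Q in auto)
      ultimately have "fst (growth rule321 A i (Suc j)) = fst (growth rule321 A i j)"
        "fst (growth rule321 A (Suc i) j) = fst (growth rule321 A i j)"
        by (simp_all add: lis_converse) (simp_all add: lis_def)
      then have "growth rule321 A i (Suc j) = growth rule321 A (Suc i) j"
        using r321.cellD(1,2)[OF c[of i j]] ch unfolding step_def by (auto simp: prod_eq_iff)
      then show False
        using r321.cellD(9)[OF c[of i j]] ch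
          \<open>fst (growth rule321 A i (Suc j)) = fst (growth rule321 A i j)\<close>
        by (auto simp: ok321_def)
    qed
  qed
  then show "\<not> has321 B A" unfolding has321_def by blast
next
  assume *: "A \<subseteq> B \<and> partial_perm A \<and> \<not> has321 B A"
  then have pp: "partial_perm A" by simp
  show "r321.good B A"
  proof (rule r321.goodI[OF assms])
    fix i j assume ij: "(i, j) \<in> B"
      and cell: "\<And>u v. u \<le> i \<Longrightarrow> v \<le> j \<Longrightarrow> (u, v) \<noteq> (i, j) \<Longrightarrow> r321.cell A u v"
    show "ok321 (growth rule321 A i j) (growth rule321 A i (Suc j))
      (growth rule321 A (Suc i) j) ((i, j) \<in> A)"
      unfolding ok321_def
    proof
      assume bad: "growth rule321 A i (Suc j) = growth rule321 A (Suc i) j \<and>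
        growth rule321 A i (Suc j) \<noteq> growth rule321 A i j \<and>
        fst (growth rule321 A i (Suc j)) = fst (growth rule321 A i j)"
      then have L: "lis A i (Suc j) = lis A i j" "lis A (Suc i) j = lis A i j"
        unfolding lis_def by metis+
      obtain c where c: "c < i" "(c, j) \<in> A"
        using r321.row_change[of i A j] cell bad by fastforce
      obtain b where b: "b < j" "(i, b) \<in> A"
        using r321.col_change[of j A i] cell bad by fastforce
      have cL: "Suc (lis A c j) \<le> lis A i j"
        using lis_le[OF c(2,1), of "Suc j"] L by simp
      have bL: "Suc (lis A i b) \<le> lis A i j"
        using lis_le[OF b(2), of "Suc i" j] b L by simp
      \<comment> \<open>The last entry of a longest chain serves as the middle of the
        \<open>321\<close>: the values of \<open>lis\<close> at \<open>(c, j)\<close> and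
        \<open>(i, b)\<close> are smaller than at \<open>(i, j)\<close>, which forces it to the
        right of the former and above the latter.\<close>
      obtain u v where uv: "(u, v) \<in> A" "u < i" "v < j" "Suc (lis A u v) = lis A i j"
        using lis_top[of A i j] cL by auto
      have "\<not> u < c" using lis_le[OF uv(1), of c j] uv cL by auto
      moreover have "u \<noteq> c" using partial_permD(1)[OF pp uv(1)] c uv by blast
      moreover have "\<not> v < b" using lis_le[OF uv(1), of i b] uv bL by auto
      moreover have "v \<noteq> b" using partial_permD(2)[OF pp uv(1)] b uv by blast
      ultimately have "c < u" "b < v" by auto
      then have "has321 B A" unfolding has321_def using c b uv ij by blast
      then show False using * by simp
    qed
  qed (use * in auto)
qed

lemma card_symmetric_fillings:
  assumes "finite B" "down_closed B" "sym B"
  shows "card {A. A \<subseteq> B \<and> single_valued A \<and> sym A \<and> Domain A = D \<and> \<not> has123 A}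
       = card {A. A \<subseteq> B \<and> single_valued A \<and> sym A \<and> Domain A = D \<and> \<not> has321 B A}"
proof -
  have pp: "partial_perm A \<longleftrightarrow> single_valued A" if "sym A" for A :: "(nat \<times> nat) set"
    using that by (simp add: partial_perm_def sym_conv_converse_eq)
  have "{A. A \<subseteq> B \<and> single_valued A \<and> sym A \<and> Domain A = D \<and> \<not> has123 A} =
      {A. r123.good B A \<and> sym A \<and> Domain A = D}"
    using pp by (auto simp: good123_iff assms(2))
  moreover have "{A. A \<subseteq> B \<and> single_valued A \<and> sym A \<and> Domain A = D \<and> \<not> has321 B A} =
      {A. r321.good B A \<and> sym A \<and> Domain A = D}"
    using pp by (auto simp: good321_iff assms(2))
  moreover have "card {A. r123.good B A \<and> sym A \<and> Domain A = D} =
      card {A. r321.good B A \<and> sym A \<and> Domain A = D}"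
    using card_good_le[OF r123.local_rule_axioms r321.local_rule_axioms assms]
      card_good_le[OF r321.local_rule_axioms r123.local_rule_axioms assms]
    by (rule antisym)
  ultimately show ?thesis by simp
qed

section \<open>From involutions to symmetric fillings\<close>

text \<open>The strict bounds leave the cell \<open>(i, j)\<close> itself free for an entry of the
  prefix.\<close>

definition occurs :: "nat list \<Rightarrow> (nat \<times> nat) set \<Rightarrow> nat \<Rightarrow> nat \<Rightarrow> bool" where
  "occurs \<tau> S i j \<longleftrightarrow> (\<exists>ps f. set ps \<subseteq> S \<and> sorted_wrt (\<lambda>p q. fst p < fst q) ps \<and>
     (\<forall>p\<in>set ps. i < fst p \<and> j < snd p) \<and>
     strict_mono_on (snd ` set ps) f \<and> map (f \<circ> snd) ps = \<tau>)"

text \<open>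
  The shadow of an involution is the set of cells below and to the left of an occurrence of \<open>\<tau>\<close>
  or of its inverse; taking both makes it symmetric.
\<close>

definition shadow :: "nat \<Rightarrow> nat list \<Rightarrow> (nat \<times> nat) set \<Rightarrow> (nat \<times> nat) set" where
  "shadow n \<tau> S = {(i, j). i \<le> n \<and> j \<le> n \<and> (occurs \<tau> S i j \<or> occurs \<tau> S j i)}"

text \<open>Points are used directly as cells, so column 0 and row 0 of the board stay
  empty.\<close>

definition inv_graph :: "nat \<Rightarrow> (nat \<times> nat) set \<Rightarrow> bool" where
  "inv_graph n S \<longleftrightarrow> sym S \<and> single_valued S \<and> Domain S = {1..n}"

lemma occurs_mono:
  assumes "occurs \<tau> S i j" "S \<subseteq> S'" "i' \<le> i" "j' \<le> j"
  shows "occurs \<tau> S' i' j'"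
proof -
  obtain ps f where *: "set ps \<subseteq> S" "sorted_wrt (\<lambda>p q. fst p < fst q) ps"
     "\<forall>p\<in>set ps. i < fst p \<and> j < snd p"
     "strict_mono_on (snd ` set ps) f" "map (f \<circ> snd) ps = \<tau>"
    using assms(1) unfolding occurs_def by blast
  then have "set ps \<subseteq> S'" "\<forall>p\<in>set ps. i' < fst p \<and> j' < snd p"
    using assms(2-4) by fastforce+
  then show ?thesis unfolding occurs_def using *(2,4,5) by blast
qed

lemma shadow_mono: "S \<subseteq> S' \<Longrightarrow> shadow n \<tau> S \<subseteq> shadow n \<tau> S'"
  unfolding shadow_def using occurs_mono by blast

text \<open>The bounds in \<open>shadow\<close> matter for empty \<tau>, which occurs beyond every
  cell.\<close>

lemma finite_shadow: "finite (shadow n \<tau> S)"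
  by (rule finite_subset[of _ "{..n} \<times> {..n}"]) (auto simp: shadow_def)

lemma down_closed_shadow: "down_closed (shadow n \<tau> S)"
  unfolding down_closed_def
proof (intro allI impI)
  fix i j u v assume *: "(i, j) \<in> shadow n \<tau> S" "u \<le> i" "v \<le> j"
  then have "occurs \<tau> S u v \<or> occurs \<tau> S v u"
    using occurs_mono[OF _ subset_refl] unfolding shadow_def by blast
  then show "(u, v) \<in> shadow n \<tau> S" using * by (auto simp: shadow_def)
qed

lemma sym_shadow: "sym (shadow n \<tau> S)"
  by (rule symI) (auto simp: shadow_def)

text \<open>
  An occurrence beyond a maximal cell of the shadow consists of points outside the shadow, so the
  shadow does not change when the points inside it are rearranged.
\<close>

lemma shadow_diff_shadow: "shadow n \<tau> (S - shadow n \<tau> S) = shadow n \<tau> S"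
proof
  let ?B = "shadow n \<tau> S"
  show "shadow n \<tau> (S - ?B) \<subseteq> ?B" by (rule shadow_mono) auto
  show "?B \<subseteq> shadow n \<tau> (S - ?B)"
  proof (rule subrelI)
    fix i j assume ij: "(i, j) \<in> ?B"
    \<comment> \<open>Shadow cells weakly beyond \<open>(i, j)\<close>. One with maximal coordinate
      sum has no shadow cell strictly above and to the right of it, so an occurrence beyond it
      avoids the shadow.\<close>
    define C where "C = {(u, v). (u, v) \<in> ?B \<and> i \<le> u \<and> j \<le> v}"
    define h :: "nat \<times> nat \<Rightarrow> nat" where "h q = fst q + snd q" for q
    have C: "finite (h ` C)" "h ` C \<noteq> {}"
      using ij by (auto simp: C_def intro: finite_subset[OF _ finite_shadow[of n \<tau> S]])
    then obtain p where p: "p \<in> C" "Max (h ` C) = h p"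
      using Max_in[OF C] by (elim imageE)
    have max: "h q \<le> h p" if "q \<in> C" for q
      using Max_ge[OF C(1), of "h q"] that p(2) by simp
    obtain u v where uv: "p = (u, v)" by fastforce
    have no: "(a, b) \<notin> ?B" if "u < a" "v < b" for a b
      using max[of "(a, b)"] p(1) that by (auto simp: uv C_def h_def)
    have avoid: "occurs \<tau> (S - ?B) a b"
      if occ: "occurs \<tau> S a b" and ab: "(a, b) = (u, v) \<or> (a, b) = (v, u)" for a b
    proof -
      obtain ps f where *: "set ps \<subseteq> S" "sorted_wrt (\<lambda>p q. fst p < fst q) ps"
         "\<forall>p\<in>set ps. a < fst p \<and> b < snd p"
         "strict_mono_on (snd ` set ps) f" "map (f \<circ> snd) ps = \<tau>"
        using occ unfolding occurs_def by blast
      have "q \<notin> ?B" if "q \<in> set ps" for q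
        using no[of "fst q" "snd q"] no[of "snd q" "fst q"] *(3) that ab
          symD[OF sym_shadow, of "fst q" "snd q"] by auto
      then have "set ps \<subseteq> S - ?B" using *(1) by blast
      then show ?thesis unfolding occurs_def using *(2-5) by blast
    qed
    have "(u, v) \<in> ?B" using p(1) by (simp add: uv C_def)
    then have "(u, v) \<in> shadow n \<tau> (S - ?B)"
      using avoid[of u v] avoid[of v u] unfolding shadow_def by blast
    then show "(i, j) \<in> shadow n \<tau> (S - ?B)"
      using down_closedD[OF down_closed_shadow] p(1) by (simp add: uv C_def)
  qed
qed

section \<open>Involutions with a fixed board and fixed entries outside it\<close>

lemma Domain_Int_single_valued:
  "single_valued S \<Longrightarrow> Domain (S \<inter> B) = Domain S - Domain (S - B)"
  by (auto dest: single_valuedD)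

lemma inv_graph_subset: "inv_graph n S \<Longrightarrow> S \<subseteq> {1..n} \<times> {1..n}"
  unfolding inv_graph_def by (auto dest: symD)

lemma finite_inv_graph: "finite {S. inv_graph n S}"
  by (rule finite_subset[of _ "Pow ({1..n} \<times> {1..n})"]) (use inv_graph_subset in auto)

text \<open>Once the board and the outer entries \<open>R\<close> are fixed, only the part inside
  the board varies. By \<open>shadow_diff_shadow\<close> it may be any symmetric filling of the
  columns that \<open>R\<close> leaves free.\<close>

lemma card_fibre:
  fixes P :: "(nat \<times> nat) set \<Rightarrow> (nat \<times> nat) set \<Rightarrow> bool"
  assumes S0: "inv_graph n S0" and B: "B = shadow n \<tau> S0" and O: "R = S0 - B"
  shows "card {S. inv_graph n S \<and> P (shadow n \<tau> S) (S \<inter> shadow n \<tau> S) \<and>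
           shadow n \<tau> S = B \<and> S - shadow n \<tau> S = R} =
         card {A. A \<subseteq> B \<and> single_valued A \<and> sym A \<and> Domain A = {1..n} - Domain R \<and> P B A}"
    (is "card ?X = card ?Y")
proof -
  have symB: "sym B" unfolding B by (rule sym_shadow)
  have R: "sym R" "single_valued R" "Domain R \<subseteq> {1..n}" "R \<inter> B = {}"
    using S0 symB unfolding O inv_graph_def sym_def single_valued_def by blast+
  have "bij_betw (\<lambda>S. S \<inter> B) ?X ?Y"
  proof (rule bij_betw_byWitness[where f' = "\<lambda>A. A \<union> R"])
    show "\<forall>S\<in>?X. S \<inter> B \<union> R = S" by auto
    show "\<forall>A\<in>?Y. (A \<union> R) \<inter> B = A" using R(4) by auto
    show "(\<lambda>S. S \<inter> B) ` ?X \<subseteq> ?Y"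
    proof (intro image_subsetI)
      fix S assume S: "S \<in> ?X"
      then have "sym S" "single_valued S" "Domain S = {1..n}" by (auto simp: inv_graph_def)
      then have "sym (S \<inter> B)" "single_valued (S \<inter> B)" "Domain (S \<inter> B) = {1..n} - Domain R"
        using symB Domain_Int_single_valued[of S B] S
        by (auto intro: sym_Int simp: single_valued_def)
      then show "S \<inter> B \<in> ?Y" using S by auto
    qed
    show "(\<lambda>A. A \<union> R) ` ?Y \<subseteq> ?X"
    proof (intro image_subsetI)
      fix A assume A: "A \<in> ?Y"
      let ?S = "A \<union> R"
      have "Domain A \<inter> Domain R = {}" using A by auto
      then have "single_valued ?S"
        using A R(2) unfolding single_valued_def by blast
      moreover have "sym ?S" using A R(1) by (auto intro: sym_Un)
      moreover have "Domain ?S = {1..n}" using A R(3) by auto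
      moreover have sh: "shadow n \<tau> ?S = B"
      proof
        have RB: "shadow n \<tau> R = B" unfolding O B by (rule shadow_diff_shadow)
        then show ge: "B \<subseteq> shadow n \<tau> ?S" using shadow_mono[of R ?S n \<tau>] by auto
        \<comment> \<open>\<open>A\<close> lies in \<open>B\<close> and hence in the shadow of
          \<open>?S\<close>, so removing that shadow leaves only entries of
          \<open>R\<close>.\<close>
        have "?S - shadow n \<tau> ?S \<subseteq> R" using A ge by auto
        then show "shadow n \<tau> ?S \<subseteq> B"
          using shadow_mono[of "?S - shadow n \<tau> ?S" R n \<tau>] RB by (simp add: shadow_diff_shadow)
      qed
      moreover have "?S - B = R" "?S \<inter> B = A" using A R(4) by auto
      ultimately show "?S \<in> ?X" using A by (auto simp: inv_graph_def)
    qed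
  qed
  then show ?thesis by (rule bij_betw_same_card)
qed

text \<open>Summation over all pairs of board and outer entries reduces the claim to a single fibre,
  where \<open>card_symmetric_fillings\<close> applies.\<close>

lemma card_inv_graph:
  "card {S. inv_graph n S \<and> \<not> has123 (S \<inter> shadow n \<tau> S)} =
   card {S. inv_graph n S \<and> \<not> has321 (shadow n \<tau> S) (S \<inter> shadow n \<tau> S)}"
proof -
  let ?I = "{S. inv_graph n S}"
  let ?key = "\<lambda>S. (shadow n \<tau> S, S - shadow n \<tau> S)"
  have split: "card {S. inv_graph n S \<and> P (shadow n \<tau> S) (S \<inter> shadow n \<tau> S)} =
    (\<Sum>k\<in>?key ` ?I. card {S. inv_graph n S \<and> P (shadow n \<tau> S) (S \<inter> shadow n \<tau> S) \<and>
       shadow n \<tau> S = fst k \<and> S - shadow n \<tau> S = snd k})"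
    for P :: "(nat \<times> nat) set \<Rightarrow> (nat \<times> nat) set \<Rightarrow> bool"
  proof -
    let ?X = "{S. inv_graph n S \<and> P (shadow n \<tau> S) (S \<inter> shadow n \<tau> S)}"
    have "finite ?X" by (rule finite_subset[OF _ finite_inv_graph]) auto
    moreover have "finite (?key ` ?I)" using finite_inv_graph by (rule finite_imageI)
    moreover have "?key ` ?X \<subseteq> ?key ` ?I" by auto
    ultimately have "(\<Sum>k\<in>?key ` ?I. \<Sum>S\<in>{S \<in> ?X. ?key S = k}. 1) = (\<Sum>S\<in>?X. 1::nat)"
      by (rule sum.group)
    then have "card ?X = (\<Sum>k\<in>?key ` ?I. card {S \<in> ?X. ?key S = k})"
      by (simp only: card_eq_sum)
    also have "\<dots> = (\<Sum>k\<in>?key ` ?I. card {S. inv_graph n S \<and>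
       P (shadow n \<tau> S) (S \<inter> shadow n \<tau> S) \<and> shadow n \<tau> S = fst k \<and> S - shadow n \<tau> S = snd k})"
      by (intro sum.cong refl arg_cong[of _ _ card]) auto
    finally show ?thesis .
  qed
  show ?thesis
    unfolding split[of "\<lambda>B A. \<not> has123 A"] split[of "\<lambda>B A. \<not> has321 B A"]
  proof (rule sum.cong[OF refl])
    fix k assume "k \<in> ?key ` ?I"
    then obtain S0 where S0: "inv_graph n S0" "fst k = shadow n \<tau> S0" "snd k = S0 - fst k" by auto
    show "card {S. inv_graph n S \<and> \<not> has123 (S \<inter> shadow n \<tau> S) \<and>
        shadow n \<tau> S = fst k \<and> S - shadow n \<tau> S = snd k} =
      card {S. inv_graph n S \<and> \<not> has321 (shadow n \<tau> S) (S \<inter> shadow n \<tau> S) \<and>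
        shadow n \<tau> S = fst k \<and> S - shadow n \<tau> S = snd k}"
      using card_fibre[OF S0, of "\<lambda>B A. \<not> has123 A"] card_fibre[OF S0, of "\<lambda>B A. \<not> has321 B A"]
        card_symmetric_fillings[of "fst k" "{1..n} - Domain (snd k)"]
      by (simp add: S0(2) finite_shadow down_closed_shadow sym_shadow)
  qed
qed

section \<open>Graphs of involutions and the patterns in them\<close>

definition graph_upto :: "nat \<Rightarrow> (nat \<Rightarrow> nat) \<Rightarrow> (nat \<times> nat) set" where
  "graph_upto n \<pi> = {(i, \<pi> i) |i. i \<in> {1..n}}"

lemma bij_betw_graph_upto:
  "bij_betw (graph_upto n) {\<pi>. \<pi> permutes {1..n} \<and> \<pi> \<circ> \<pi> = id} {S. inv_graph n S}"
proof (rule bij_betw_imageI)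
  show "inj_on (graph_upto n) {\<pi>. \<pi> permutes {1..n} \<and> \<pi> \<circ> \<pi> = id}"
  proof (rule inj_onI, rule ext)
    fix \<pi> \<rho> x
    assume *: "\<pi> \<in> {\<pi>. \<pi> permutes {1..n} \<and> \<pi> \<circ> \<pi> = id}" "\<rho> \<in> {\<pi>. \<pi> permutes {1..n} \<and> \<pi> \<circ> \<pi> = id}"
      and eq: "graph_upto n \<pi> = graph_upto n \<rho>"
    show "\<pi> x = \<rho> x"
    proof (cases "x \<in> {1..n}")
      case True
      then have "(x, \<pi> x) \<in> graph_upto n \<rho>" unfolding eq[symmetric] by (auto simp: graph_upto_def)
      then show ?thesis by (auto simp: graph_upto_def)
    next
      case False
      then show ?thesis using * permutes_not_in by (metis mem_Collect_eq)
    qed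
  qed
  show "graph_upto n ` {\<pi>. \<pi> permutes {1..n} \<and> \<pi> \<circ> \<pi> = id} = {S. inv_graph n S}"
  proof (intro equalityI subsetI)
    fix S assume "S \<in> graph_upto n ` {\<pi>. \<pi> permutes {1..n} \<and> \<pi> \<circ> \<pi> = id}"
    then obtain \<pi> where \<pi>: "\<pi> permutes {1..n}" "\<pi> \<circ> \<pi> = id" "S = graph_upto n \<pi>" by auto
    have "\<pi> i \<in> {1..n}" if "i \<in> {1..n}" for i
      using permutes_in_image[OF \<pi>(1)] that by blast
    moreover have "\<pi> (\<pi> i) = i" for i using \<pi>(2) by (metis comp_apply id_apply)
    ultimately have "sym S" unfolding \<pi>(3) graph_upto_def by (intro symI) force
    then show "S \<in> {S. inv_graph n S}"
      unfolding inv_graph_def \<pi>(3) graph_upto_def by (auto simp: single_valued_def)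
  next
    fix S assume "S \<in> {S. inv_graph n S}"
    then have S: "sym S" "single_valued S" "Domain S = {1..n}" by (auto simp: inv_graph_def)
    \<comment> \<open>Outside \<open>{1..n}\<close> the value \<open>x\<close> is forced by
      \<open>permutes\<close>.\<close>
    define \<pi> where "\<pi> x = (if x \<in> {1..n} then THE y. (x, y) \<in> S else x)" for x
    have \<pi>: "(x, y) \<in> S \<longleftrightarrow> x \<in> {1..n} \<and> y = \<pi> x" for x y
    proof
      assume xy: "(x, y) \<in> S"
      then have "(THE y. (x, y) \<in> S) = y" using S(2) by (auto dest: single_valuedD)
      then show "x \<in> {1..n} \<and> y = \<pi> x" using xy S(3) by (auto simp: \<pi>_def)
    next
      assume *: "x \<in> {1..n} \<and> y = \<pi> x"
      then obtain z where z: "(x, z) \<in> S" using S(3) by blast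
      then have "(THE y. (x, y) \<in> S) = z" using S(2) by (auto dest: single_valuedD)
      then show "(x, y) \<in> S" using z * by (auto simp: \<pi>_def)
    qed
    have inv: "\<pi> (\<pi> x) = x" for x
    proof (cases "x \<in> {1..n}")
      case True
      then have "(\<pi> x, x) \<in> S" using \<pi> symD[OF S(1)] by blast
      then show ?thesis using \<pi> by simp
    next
      case False
      then show ?thesis unfolding \<pi>_def by presburger
    qed
    then have "\<pi> permutes {1..n}"
      unfolding permutes_def by (metis \<pi>_def)
    moreover have "\<pi> \<circ> \<pi> = id" using inv by (simp add: fun_eq_iff)
    moreover have "S = graph_upto n \<pi>" using \<pi> by (auto simp: graph_upto_def)
    ultimately show "S \<in> graph_upto n ` {\<pi>. \<pi> permutes {1..n} \<and> \<pi> \<circ> \<pi> = id}" by blast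
  qed
qed

text \<open>Lists of points retain the positions, which the values alone do not show and which
  reflection in the diagonal needs.\<close>

lemma subseq_one_line_iff:
  "subseq ys (one_line n \<pi>) \<longleftrightarrow> (\<exists>ps. set ps \<subseteq> graph_upto n \<pi> \<and>
     sorted_wrt (\<lambda>p q. fst p < fst q) ps \<and> map snd ps = ys)"
proof
  assume "subseq ys (one_line n \<pi>)"
  then obtain N where N: "ys = map \<pi> (nths [1..<Suc n] N)"
    by (auto simp: subseq_conv_nths one_line_def nths_map)
  have "sorted_wrt (<) (nths [1..<Suc n] N)" 
    by (simp add: strict_sorted_iff sorted_nths del: upt_Suc)
  moreover have "set (nths [1..<Suc n] N) \<subseteq> {1..n}" using set_nths_subset by fastforce
  ultimately show "\<exists>ps. set ps \<subseteq> graph_upto n \<pi> \<and>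
     sorted_wrt (\<lambda>p q. fst p < fst q) ps \<and> map snd ps = ys"
    unfolding N
    by (intro exI[of _ "map (\<lambda>i. (i, \<pi> i)) (nths [1..<Suc n] N)"])
      (auto simp: sorted_wrt_map graph_upto_def)
next
  assume "\<exists>ps. set ps \<subseteq> graph_upto n \<pi> \<and>
     sorted_wrt (\<lambda>p q. fst p < fst q) ps \<and> map snd ps = ys"
  then obtain ps where ps: "set ps \<subseteq> graph_upto n \<pi>" "sorted_wrt (\<lambda>p q. fst p < fst q) ps"
    "map snd ps = ys" by blast
  have "sorted_wrt (<) (map fst ps)" using ps(2) by (simp add: sorted_wrt_map)
  moreover have "set (map fst ps) \<subseteq> set [1..<Suc n]" using ps(1) by (auto simp: graph_upto_def)
  ultimately have "subseq (map fst ps) [1..<Suc n]"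
    by (intro sorted_subset_imp_subseq) (auto simp: strict_sorted_iff simp del: upt_Suc)
  then have "subseq (map \<pi> (map fst ps)) (one_line n \<pi>)"
    unfolding one_line_def by (rule subseq_map)
  moreover have "map \<pi> (map fst ps) = ys"
    using ps(1) unfolding ps(3)[symmetric] by (auto simp: graph_upto_def)
  ultimately show "subseq ys (one_line n \<pi>)" by simp
qed

text \<open>Since the values of \<alpha> are below those of \<tau>, the part of an occurrence for
  \<tau> lies strictly above and to the right of the bounding box of the part for \<alpha>.\<close>

lemma contains_append_iff:
  assumes "\<alpha> \<noteq> []" "\<forall>a\<in>set \<alpha>. \<forall>t\<in>set \<tau>. a < t"
  shows "contains_pattern (one_line n \<pi>) (\<alpha> @ \<tau>) \<longleftrightarrow>
    (\<exists>ps g i j. set ps \<subseteq> graph_upto n \<pi> \<and> sorted_wrt (\<lambda>p q. fst p < fst q) ps \<and>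
       strict_mono_on (snd ` set ps) g \<and> map (g \<circ> snd) ps = \<alpha> \<and>
       (\<forall>p\<in>set ps. fst p \<le> i \<and> snd p \<le> j) \<and> occurs \<tau> (graph_upto n \<pi>) i j)"
    (is "_ \<longleftrightarrow> ?R")
proof
  assume "contains_pattern (one_line n \<pi>) (\<alpha> @ \<tau>)"
  then obtain ps f where ps: "set ps \<subseteq> graph_upto n \<pi>" "sorted_wrt (\<lambda>p q. fst p < fst q) ps"
    "strict_mono_on (snd ` set ps) f" "map (f \<circ> snd) ps = \<alpha> @ \<tau>"
    unfolding contains_pattern_def subseq_one_line_iff by (auto simp: map_map[symmetric] simp del: map_map)
  then obtain ps1 ps2 where sp: "ps = ps1 @ ps2" "map (f \<circ> snd) ps1 = \<alpha>" "map (f \<circ> snd) ps2 = \<tau>"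
    by (auto simp: map_eq_append_conv)
  have ne: "set ps1 \<noteq> {}" using sp(2) assms(1) by auto
  \<comment> \<open>The upper right corner of the bounding box, defined because \<alpha> is
    nonempty.\<close>
  define i where "i = Max (fst ` set ps1)"
  define j where "j = Max (snd ` set ps1)"
  have le: "\<forall>p\<in>set ps1. fst p \<le> i \<and> snd p \<le> j" by (auto simp: i_def j_def)
  have lt: "i < fst q \<and> j < snd q" if q: "q \<in> set ps2" for q
  proof -
    have "fst p < fst q" if "p \<in> set ps1" for p
      using ps(2) that q by (auto simp: sp(1) sorted_wrt_append)
    moreover have "snd p < snd q" if p: "p \<in> set ps1" for p
    proof -
      have "f (snd p) < f (snd q)"
        using assms(2) p q sp(2,3) by fastforce
      then show ?thesis
        using strict_mono_on_less[OF ps(3), of "snd p" "snd q"] p q by (auto simp: sp(1))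
    qed
    ultimately show ?thesis using ne by (auto simp: i_def j_def)
  qed
  have "occurs \<tau> (graph_upto n \<pi>) i j"
    unfolding occurs_def
  proof (intro exI conjI)
    show "strict_mono_on (snd ` set ps2) f"
      by (rule monotone_on_subset[OF ps(3)]) (auto simp: sp(1))
  qed (use ps sp lt in \<open>auto simp: sorted_wrt_append\<close>)
  moreover have "strict_mono_on (snd ` set ps1) f"
    by (rule monotone_on_subset[OF ps(3)]) (auto simp: sp(1))
  ultimately show ?R
    using ps sp le by (intro exI[of _ ps1] exI[of _ f] exI[of _ i] exI[of _ j])
      (auto simp: sorted_wrt_append)
next
  assume ?R
  then obtain ps1 g i j where p1: "set ps1 \<subseteq> graph_upto n \<pi>" "sorted_wrt (\<lambda>p q. fst p < fst q) ps1"
    "strict_mono_on (snd ` set ps1) g" "map (g \<circ> snd) ps1 = \<alpha>"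
    "\<forall>p\<in>set ps1. fst p \<le> i \<and> snd p \<le> j" "occurs \<tau> (graph_upto n \<pi>) i j" by blast
  then obtain ps2 f where p2: "set ps2 \<subseteq> graph_upto n \<pi>" "sorted_wrt (\<lambda>p q. fst p < fst q) ps2"
    "\<forall>p\<in>set ps2. i < fst p \<and> j < snd p" "strict_mono_on (snd ` set ps2) f"
    "map (f \<circ> snd) ps2 = \<tau>" unfolding occurs_def by blast
  \<comment> \<open>The two relabellings are glued at height \<open>j\<close>, which separates the
    values of the two parts.\<close>
  define h where "h v = (if v \<le> j then g v else f v)" for v
  have h1: "h (snd p) = g (snd p)" if "p \<in> set ps1" for p using p1(5) that by (auto simp: h_def)
  have h2: "h (snd p) = f (snd p)" if "p \<in> set ps2" for p using p2(3) that by (auto simp: h_def)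
  have "map (h \<circ> snd) ps1 = map (g \<circ> snd) ps1" "map (h \<circ> snd) ps2 = map (f \<circ> snd) ps2"
    using h1 h2 by auto
  then have mp: "map h (map snd (ps1 @ ps2)) = \<alpha> @ \<tau>" using p1(4) p2(5) by simp
  have gf: "g (snd p) < f (snd q)" if "p \<in> set ps1" "q \<in> set ps2" for p q
    using assms(2) p1(4) p2(5) that by fastforce
  have "strict_mono_on (set (map snd (ps1 @ ps2))) h"
  proof (rule strict_mono_onI)
    fix v w assume "v \<in> set (map snd (ps1 @ ps2))" "w \<in> set (map snd (ps1 @ ps2))" and vw: "v < w"
    then obtain p q where p: "v = snd p" "p \<in> set ps1 \<or> p \<in> set ps2"
      and q: "w = snd q" "q \<in> set ps1 \<or> q \<in> set ps2" by auto
    consider "p \<in> set ps1" "q \<in> set ps1" | "p \<in> set ps1" "q \<in> set ps2" |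
      "p \<in> set ps2" "q \<in> set ps2" | "p \<in> set ps2" "q \<in> set ps1" using p q by blast
    then show "h v < h w"
    proof cases
      case 1
      then show ?thesis using strict_mono_onD[OF p1(3), of v w] vw p q h1 by auto
    next
      case 2
      then show ?thesis using p q h1 h2 gf by auto
    next
      case 3
      then show ?thesis using strict_mono_onD[OF p2(4), of v w] vw p q h2 by auto
    next
      case 4
      then show ?thesis using p1(5) p2(3) vw p q by fastforce
    qed
  qed
  moreover have "subseq (map snd (ps1 @ ps2)) (one_line n \<pi>)"
    unfolding subseq_one_line_iff
    by (rule exI[of _ "ps1 @ ps2"])
      (use p1 p2 in \<open>fastforce simp: sorted_wrt_append\<close>)
  ultimately show "contains_pattern (one_line n \<pi>) (\<alpha> @ \<tau>)"
    unfolding contains_pattern_def using mp by blast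
qed

text \<open>A shadow cell may owe its place to an occurrence of \<tau> beyond the reflected cell.
  Reflection preserves the graph of an involution, and \<open>123\<close> is its own inverse, so the
  reflected chain then serves as the prefix.\<close>

lemma contains_123_iff:
  assumes S: "inv_graph n (graph_upto n \<pi>)" and "\<forall>t\<in>set \<tau>. 3 < t"
  shows "contains_pattern (one_line n \<pi>) ([1, 2, 3] @ \<tau>) \<longleftrightarrow>
    has123 (graph_upto n \<pi> \<inter> shadow n \<tau> (graph_upto n \<pi>))" (is "_ \<longleftrightarrow> has123 (?S \<inter> ?B)")
proof -
  have lt: "\<forall>a\<in>set [1, 2, 3::nat]. \<forall>t\<in>set \<tau>. a < t" using assms(2) by fastforce
  note sub = inv_graph_subset[OF S]
  show ?thesis
    unfolding contains_append_iff[OF list.distinct(2) lt, of n \<pi>]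
  proof
    assume "\<exists>ps g i j. set ps \<subseteq> ?S \<and> sorted_wrt (\<lambda>p q. fst p < fst q) ps \<and>
       strict_mono_on (snd ` set ps) g \<and> map (g \<circ> snd) ps = [1, 2, 3::nat] \<and>
       (\<forall>p\<in>set ps. fst p \<le> i \<and> snd p \<le> j) \<and> occurs \<tau> ?S i j"
    then obtain ps g i j where *: "set ps \<subseteq> ?S" "sorted_wrt (\<lambda>p q. fst p < fst q) ps"
       "strict_mono_on (snd ` set ps) g" "map (g \<circ> snd) ps = [1, 2, 3::nat]"
       "\<forall>p\<in>set ps. fst p \<le> i \<and> snd p \<le> j" "occurs \<tau> ?S i j"
      by (elim exE conjE) (rule that)
    from *(4) obtain i1 j1 i2 j2 i3 j3 where ps: "ps = [(i1, j1), (i2, j2), (i3, j3)]"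
      "g j1 = 1" "g j2 = 2" "g j3 = 3" by (auto simp: map_eq_Cons_conv)
    have "j1 < j2" "j2 < j3"
      using strict_mono_on_less[OF *(3), of j1 j2] strict_mono_on_less[OF *(3), of j2 j3]
      by (auto simp: ps)
    moreover have "i1 < i2" "i2 < i3" using *(2) by (auto simp: ps)
    moreover have "(i3, j3) \<in> ?B"
      using occurs_mono[OF *(6) subset_refl, of i3 j3] *(1,5) sub by (auto simp: ps shadow_def)
    moreover from this have "(i1, j1) \<in> ?B" "(i2, j2) \<in> ?B"
      using down_closedD[OF down_closed_shadow] calculation by (meson less_imp_le less_trans)+
    moreover have "(i1, j1) \<in> ?S" "(i2, j2) \<in> ?S" "(i3, j3) \<in> ?S"
      using *(1) by (auto simp: ps)
    ultimately show "has123 (?S \<inter> ?B)" unfolding has123_def by blast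
  next
    assume "has123 (?S \<inter> ?B)"
    then obtain i1 j1 i2 j2 i3 j3 where *: "(i1, j1) \<in> ?S" "(i2, j2) \<in> ?S" "(i3, j3) \<in> ?S"
      "i1 < i2" "i2 < i3" "j1 < j2" "j2 < j3" "(i3, j3) \<in> ?B" unfolding has123_def by blast
    have sy: "(j1, i1) \<in> ?S" "(j2, i2) \<in> ?S" "(j3, i3) \<in> ?S"
      using * S by (auto simp: inv_graph_def dest: symD)
    have "occurs \<tau> ?S i3 j3 \<or> occurs \<tau> ?S j3 i3" using *(8) by (auto simp: shadow_def)
    then show "\<exists>ps g i j. set ps \<subseteq> ?S \<and> sorted_wrt (\<lambda>p q. fst p < fst q) ps \<and>
       strict_mono_on (snd ` set ps) g \<and> map (g \<circ> snd) ps = [1, 2, 3::nat] \<and>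
       (\<forall>p\<in>set ps. fst p \<le> i \<and> snd p \<le> j) \<and> occurs \<tau> ?S i j"
    proof
      assume "occurs \<tau> ?S i3 j3"
      then show ?thesis using *
        by (intro exI[of _ "[(i1, j1), (i2, j2), (i3, j3)]"] exI[of _ i3] exI[of _ j3]
            exI[of _ "\<lambda>v. if v = j1 then 1 else if v = j2 then 2 else 3"])
          (auto simp: strict_mono_on_def)
    next
      assume "occurs \<tau> ?S j3 i3"
      then show ?thesis using * sy
        by (intro exI[of _ "[(j1, i1), (j2, i2), (j3, i3)]"] exI[of _ j3] exI[of _ i3]
            exI[of _ "\<lambda>v. if v = i1 then 1 else if v = i2 then 2 else 3"])
          (auto simp: strict_mono_on_def)
    qed
  qed
qed

text \<open>The same reflection works, but the decisive cell is now the corner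
  \<open>(i3, j1)\<close> of the spanned rectangle, which need not be an entry.\<close>

lemma contains_321_iff:
  assumes S: "inv_graph n (graph_upto n \<pi>)" and "\<forall>t\<in>set \<tau>. 3 < t"
  shows "contains_pattern (one_line n \<pi>) ([3, 2, 1] @ \<tau>) \<longleftrightarrow>
    has321 (shadow n \<tau> (graph_upto n \<pi>)) (graph_upto n \<pi> \<inter> shadow n \<tau> (graph_upto n \<pi>))"
    (is "_ \<longleftrightarrow> has321 ?B (?S \<inter> ?B)")
proof -
  have lt: "\<forall>a\<in>set [3, 2, 1::nat]. \<forall>t\<in>set \<tau>. a < t" using assms(2) by fastforce
  note sub = inv_graph_subset[OF S]
  show ?thesis
    unfolding contains_append_iff[OF list.distinct(2) lt, of n \<pi>]
  proof
    assume "\<exists>ps g i j. set ps \<subseteq> ?S \<and> sorted_wrt (\<lambda>p q. fst p < fst q) ps \<and>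
       strict_mono_on (snd ` set ps) g \<and> map (g \<circ> snd) ps = [3, 2, 1::nat] \<and>
       (\<forall>p\<in>set ps. fst p \<le> i \<and> snd p \<le> j) \<and> occurs \<tau> ?S i j"
    then obtain ps g i j where *: "set ps \<subseteq> ?S" "sorted_wrt (\<lambda>p q. fst p < fst q) ps"
       "strict_mono_on (snd ` set ps) g" "map (g \<circ> snd) ps = [3, 2, 1::nat]"
       "\<forall>p\<in>set ps. fst p \<le> i \<and> snd p \<le> j" "occurs \<tau> ?S i j"
      by (elim exE conjE) (rule that)
    from *(4) obtain i1 j1 i2 j2 i3 j3 where ps: "ps = [(i1, j1), (i2, j2), (i3, j3)]"
      "g j1 = 3" "g j2 = 2" "g j3 = 1" by (auto simp: map_eq_Cons_conv)
    have "j2 < j1" "j3 < j2"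
      using strict_mono_on_less[OF *(3), of j2 j1] strict_mono_on_less[OF *(3), of j3 j2]
      by (auto simp: ps)
    moreover have "i1 < i2" "i2 < i3" using *(2) by (auto simp: ps)
    moreover have "(i3, j1) \<in> ?B"
      using occurs_mono[OF *(6) subset_refl, of i3 j1] *(1,5) sub by (auto simp: ps shadow_def)
    moreover from this have "(i1, j1) \<in> ?B" "(i2, j2) \<in> ?B" "(i3, j3) \<in> ?B"
      using down_closedD[OF down_closed_shadow] calculation
      by (meson less_imp_le less_trans order_refl)+
    moreover have "(i1, j1) \<in> ?S" "(i2, j2) \<in> ?S" "(i3, j3) \<in> ?S"
      using *(1) by (auto simp: ps)
    ultimately show "has321 ?B (?S \<inter> ?B)" unfolding has321_def by blast
  next
    assume "has321 ?B (?S \<inter> ?B)"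
    then obtain i1 j1 i2 j2 i3 j3 where *: "(i1, j1) \<in> ?S" "(i2, j2) \<in> ?S" "(i3, j3) \<in> ?S"
      "i1 < i2" "i2 < i3" "j2 < j1" "j3 < j2" "(i3, j1) \<in> ?B" unfolding has321_def by blast
    have sy: "(j1, i1) \<in> ?S" "(j2, i2) \<in> ?S" "(j3, i3) \<in> ?S"
      using * S by (auto simp: inv_graph_def dest: symD)
    have "occurs \<tau> ?S i3 j1 \<or> occurs \<tau> ?S j1 i3" using *(8) by (auto simp: shadow_def)
    then show "\<exists>ps g i j. set ps \<subseteq> ?S \<and> sorted_wrt (\<lambda>p q. fst p < fst q) ps \<and>
       strict_mono_on (snd ` set ps) g \<and> map (g \<circ> snd) ps = [3, 2, 1::nat] \<and>
       (\<forall>p\<in>set ps. fst p \<le> i \<and> snd p \<le> j) \<and> occurs \<tau> ?S i j"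
    proof
      assume "occurs \<tau> ?S i3 j1"
      then show ?thesis using *
        by (intro exI[of _ "[(i1, j1), (i2, j2), (i3, j3)]"] exI[of _ i3] exI[of _ j1]
            exI[of _ "\<lambda>v. if v = j1 then 3 else if v = j2 then 2 else 1"])
          (auto simp: strict_mono_on_def)
    next
      assume "occurs \<tau> ?S j1 i3"
      \<comment> \<open>Reflection reverses the left-to-right order of a decreasing chain, so the
        points are listed backwards.\<close>
      then show ?thesis using * sy
        by (intro exI[of _ "[(j3, i3), (j2, i2), (j1, i1)]"] exI[of _ j1] exI[of _ i3]
            exI[of _ "\<lambda>v. if v = i3 then 3 else if v = i2 then 2 else 1"])
          (auto simp: strict_mono_on_def)
    qed
  qed
qed

lemma num_avoiding_involutions_eq:
  assumes "\<And>\<pi>. inv_graph n (graph_upto n \<pi>) \<Longrightarrow>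
    contains_pattern (one_line n \<pi>) \<sigma> \<longleftrightarrow> \<not> P (graph_upto n \<pi>)"
  shows "num_avoiding_involutions n \<sigma> = card {S. inv_graph n S \<and> P S}"
proof -
  let ?X = "{\<pi>. \<pi> permutes {1..n} \<and> \<pi> \<circ> \<pi> = id}"
  have img: "graph_upto n ` ?X = {S. inv_graph n S}" and inj: "inj_on (graph_upto n) ?X"
    using bij_betw_graph_upto by (auto simp: bij_betw_def)
  have g: "inv_graph n (graph_upto n \<pi>)" if "\<pi> \<in> ?X" for \<pi>
    using img that by blast
  have *: "avoiding_involutions n \<sigma> = {\<pi> \<in> ?X. P (graph_upto n \<pi>)}"
    using assms[OF g] by (auto simp: avoiding_involutions_def avoids_def)
  have "graph_upto n ` {\<pi> \<in> ?X. P (graph_upto n \<pi>)} = {S \<in> graph_upto n ` ?X. P S}" by blast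
  then have "graph_upto n ` avoiding_involutions n \<sigma> = {S. inv_graph n S \<and> P S}"
    unfolding * img by simp
  moreover have "inj_on (graph_upto n) (avoiding_involutions n \<sigma>)"
    by (rule inj_on_subset[OF inj]) (auto simp: *)
  ultimately show ?thesis unfolding num_avoiding_involutions_def by (metis card_image)
qed

theorem corollary5p4:
  shows "prefixes_exchangeable 3 [1, 2, 3] [3, 2, 1]"
  unfolding prefixes_exchangeable_def involution_equiv_def
proof (intro allI impI ballI)
  fix k n :: nat and \<tau> assume "\<tau> \<in> permutations_of_set {3 + 1..k}"
  then have \<tau>: "\<forall>t\<in>set \<tau>. 3 < t" by (auto simp: permutations_of_set_def)
  show "num_avoiding_involutions n ([1, 2, 3] @ \<tau>) = num_avoiding_involutions n ([3, 2, 1] @ \<tau>)"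
    using num_avoiding_involutions_eq[of n "[1, 2, 3] @ \<tau>" "\<lambda>S. \<not> has123 (S \<inter> shadow n \<tau> S)"]
      num_avoiding_involutions_eq[of n "[3, 2, 1] @ \<tau>" "\<lambda>S. \<not> has321 (shadow n \<tau> S) (S \<inter> shadow n \<tau> S)"]
      contains_123_iff[OF _ \<tau>] contains_321_iff[OF _ \<tau>] card_inv_graph[of n \<tau>]
    by simp
qed

end
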